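(* Let $k$ be a positive integer. Every graph $G$ can be edge-decomposed into $k$ factors $G_1,\ldots, G_k$ satisfying the following properties: (1) for each vertex $v$ and each $1\le i\le k$, $|d_{G_i}(v)-d_{G}(v)/k|<2$; (2) for each $v\in V(G)$, there is at most one index $j_v$ with $d_{G_{j_v}}(v)$ odd (in particular, there is no such index when $d_G(v)$ is even). Furthermore, if $G$ is odd-$k$-edge-connected, then the factors can be chosen such that (1) and (2) hold and $j_v=1$ for all odd-degree vertices $v$.
   Context: Graphs may have loops and multiple edges; $d_G(v)$ is the degree of $v$ in $G$ (a loop counts twice). A factor of $G$ is a spanning subgraph of $G$; $G$ is edge-decomposed into factors if their edge sets partition $E(G)$. For a vertex set $A$, $d_G(A)$ is the number of edges of $G$ with exactly one end in $A$; $G$ is odd-$\lambda$-edge-connected if $d_G(A)\ge \lambda$ for every vertex set $A$ with $d_G(A)$ odd. *)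

theory Defs
  imports Complex_Main "HOL-Library.Uprod" "HOL-Library.Disjoint_Sets"
begin

text \<open>Undirected graphs with loops and multiple edges: every edge name is mapped to the
  unordered pair of its ends; an edge \<open>e\<close> with \<open>ends G e = Upair v v\<close> is a loop at \<open>v\<close>.\<close>

record ('v, 'e) multigraph =
  verts :: "'v set"
  edges :: "'e set"
  ends :: "'e \<Rightarrow> 'v uprod"

definition finite_multigraph :: "('v, 'e) multigraph \<Rightarrow> bool" where
  "finite_multigraph G \<longleftrightarrow>
     finite (verts G) \<and> finite (edges G) \<and> (\<forall>e\<in>edges G. set_uprod (ends G e) \<subseteq> verts G)"

text \<open>The second summand counts the loops at \<open>v\<close> once more, so that a loop counts twice.\<close>

definition degree :: "('v, 'e) multigraph \<Rightarrow> 'v \<Rightarrow> nat" where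
  "degree G v =
     card {e \<in> edges G. v \<in> set_uprod (ends G e)} + card {e \<in> edges G. ends G e = Upair v v}"

definition cut_degree :: "('v, 'e) multigraph \<Rightarrow> 'v set \<Rightarrow> nat" where
  "cut_degree G A = card {e \<in> edges G. \<exists>u v. ends G e = Upair u v \<and> u \<in> A \<and> v \<notin> A}"

definition odd_edge_connected :: "nat \<Rightarrow> ('v, 'e) multigraph \<Rightarrow> bool" where
  "odd_edge_connected l G \<longleftrightarrow> (\<forall>A\<subseteq>verts G. odd (cut_degree G A) \<longrightarrow> l \<le> cut_degree G A)"

text \<open>The end map of a factor matters only on the edges of the factor.\<close>

definition factor :: "('v, 'e) multigraph \<Rightarrow> ('v, 'e) multigraph \<Rightarrow> bool" where
  "factor H G \<longleftrightarrow>
     verts H = verts G \<and> edges H \<subseteq> edges G \<and> (\<forall>e\<in>edges H. ends H e = ends G e)"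

text \<open>A factor without edges is allowed, so some of the edge sets may be empty.\<close>

definition edge_decomposition ::
    "('v, 'e) multigraph \<Rightarrow> nat \<Rightarrow> (nat \<Rightarrow> ('v, 'e) multigraph) \<Rightarrow> bool" where
  "edge_decomposition G k F \<longleftrightarrow>
     (\<forall>i\<in>{1..k}. factor (F i) G) \<and>
     (\<Union>i\<in>{1..k}. edges (F i)) = edges G \<and>
     disjoint_family_on (\<lambda>i. edges (F i)) {1..k}"

end

theory Submission imports Defs begin

text \<open>
  Everything follows from the existence of a single good factor. If \<open>G\<close> is odd-\<open>k\<close>-edge-connected,
  then it has a factor whose degrees have the parity of those of \<open>G\<close> and are less than 2 away from
  \<open>d(v) / k\<close> (\<open>equitable_parity_factor\<close>). Take this as \<open>G\<^sub>1\<close>. What remains has only even degrees, so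
  it has no odd cuts at all and is odd-\<open>l\<close>-edge-connected for every \<open>l\<close>. Hence one can go on and
  split off an even factor that is equitable for \<open>k - 1\<close> parts, and so on; the bounds persist
  because an even number is less than 2 away from an average exactly if it respects all even bounds on
  this average (\<open>equitable_parity_decomposition\<close>).

  Without connectivity, the odd vertices are joined to a new vertex, which makes the graph even, and
  the even graph is decomposed. Splitting the vertices first keeps the degrees
  within bounds when the new edges are deleted again (\<open>equitable_one_odd_factor_decomposition\<close>).

  The single factor comes from rounding. The constant weight \<open>1 / k\<close> on the edges, with suitable loops
  added, is a fractional \<open>f\<close>-factor for the right function \<open>f\<close>, and odd-\<open>k\<close>-edge-connectivity is what the
  blossom inequalities ask for. Such a fractional factor yields an \<open>f\<close>-factor
  (\<open>fractional_factor\<close>). Tutte's gadget reduces this to perfect matchings: a fractional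
  perfect matching in which every odd cut has weight at least 1 contains a perfect
  matching in its support (\<open>fractional_perfect_matching\<close>). This is proved like Tutte's
  theorem, with Lovasz's exchange argument in an edge-maximal counterexample.
\<close>

section \<open>Alternating walks and the exchange of perfect matchings\<close>

text \<open>A matching is encoded by the map that sends every vertex to its partner, so that two
  matchings can be composed; when \<open>R\<close> is irreflexive, no vertex is its own partner.\<close>

definition perfect_matching :: "'a set \<Rightarrow> ('a \<times> 'a) set \<Rightarrow> ('a \<Rightarrow> 'a) \<Rightarrow> bool" where
  "perfect_matching V R m \<longleftrightarrow> (\<forall>v\<in>V. m v \<in> V \<and> m (m v) = v \<and> (v, m v) \<in> R)"

text \<open>The alternating walk from \<open>x\<close> runs round a cycle of even length and can therefore return to
  \<open>x\<close> only after an even number of steps. Cutting off two steps at each end of a walk that returns after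
  an odd number of steps would leave a shorter walk of the same kind, down to a fixed point of one
  of the two involutions.\<close>

lemma alternating_walk_no_odd_return:
  assumes m1: "\<And>v. v \<in> V \<Longrightarrow> m1 v \<in> V \<and> m1 (m1 v) = v \<and> m1 v \<noteq> v"
    and m2: "\<And>v. v \<in> V \<Longrightarrow> m2 v \<in> V \<and> m2 (m2 v) = v \<and> m2 v \<noteq> v"
    and "x \<in> V"
  shows "m2 (((m1 \<circ> m2) ^^ n) x) \<noteq> x"
  using \<open>x \<in> V\<close>
proof (induction n arbitrary: x rule: less_induct)
  case (less n)
  let ?g = "m1 \<circ> m2"
  have inV: "(?g ^^ j) y \<in> V" if "y \<in> V" for j y
    using that m1 m2 by (induction j) auto
  consider "n = 0" | "n = 1" | j where "n = Suc (Suc j)"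
    by (metis One_nat_def not0_implies_Suc)
  then show ?case
  proof cases
    case 1
    then show ?thesis using m2 less.prems by simp
  next
    case 2
    then show ?thesis using m1 m2 less.prems by simp metis
  next
    case 3
    have "m2 ((?g ^^ j) (?g x)) \<noteq> ?g x"
      using less.IH[of j "?g x"] 3 inV[of x 1] less.prems by (simp add: comp_def)
    moreover have "(?g ^^ n) x = m1 (m2 ((?g ^^ j) (?g x)))"
      using 3 by (metis comp_apply funpow.simps(2) funpow_swap1)
    moreover have "(?g ^^ j) (?g x) \<in> V"
      using inV[of "?g x" j] inV[of x 1] less.prems by simp
    ultimately show ?thesis
      using m1 m2 less.prems by (metis comp_apply)
  qed
qed

text \<open>The exchange step of Lovasz's proof of Tutte's theorem. If \<open>m1\<close> uses the extra edge \<open>ac\<close> and \<open>m2\<close>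
  the extra edge \<open>bd\<close>, consider the component of the symmetric difference of \<open>m1\<close> and \<open>m2\<close> that
  contains \<open>b\<close>, walked from \<open>b\<close> through \<open>d\<close>. If it avoids \<open>a\<close> and \<open>c\<close>, then \<open>m1\<close> inside this component
  and \<open>m2\<close> outside avoid both extra edges. Otherwise the walk is stopped at its first vertex in
  \<open>{a, c}\<close>; it arrives there along an edge of \<open>m2\<close>, and \<open>R\<close> joins that vertex to \<open>b\<close>. Now \<open>m1\<close> on the
  interior of the walk, this edge to \<open>b\<close>, and \<open>m2\<close> off the walk form a perfect matching.\<close>

lemma exchange_perfect_matchings:
  assumes fin: "finite V" and R: "R \<subseteq> V \<times> V" "sym R" "irrefl R"
    and ab: "(a, b) \<in> R" and bc: "(b, c) \<in> R" and ac: "a \<noteq> c"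
    and d: "d \<in> V" "b \<noteq> d"
    and m1: "perfect_matching V (R \<union> {(a, c), (c, a)}) m1"
    and m2: "perfect_matching V (R \<union> {(b, d), (d, b)}) m2"
  shows "\<exists>m. perfect_matching V R m"
proof (cases "m1 a = c \<and> m2 b = d")
  case False
  have "a \<in> V" "b \<in> V" "c \<in> V" using ab bc R by auto
  show ?thesis
  proof (cases "m1 a = c")
    case True
    then have "m2 b \<noteq> d" using False by simp
    then have "m2 d \<noteq> b" using m2 d unfolding perfect_matching_def by metis
    then have "perfect_matching V R m2"
      using m2 \<open>m2 b \<noteq> d\<close> unfolding perfect_matching_def by auto
    then show ?thesis by blast
  next
    case False
    then have "m1 c \<noteq> a" using m1 \<open>c \<in> V\<close> unfolding perfect_matching_def by metis
    then have "perfect_matching V R m1"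
      using m1 False unfolding perfect_matching_def by auto
    then show ?thesis by blast
  qed
next
  case True
  have V: "a \<in> V" "b \<in> V" "c \<in> V" using ab bc R by auto
  have ba: "b \<noteq> a" "b \<noteq> c" using ab bc R(3) by (auto simp: irrefl_def)
  have i1: "m1 v \<in> V \<and> m1 (m1 v) = v \<and> m1 v \<noteq> v" if "v \<in> V" for v
    using m1 that R(3) ac unfolding perfect_matching_def irrefl_def by auto
  have i2: "m2 v \<in> V \<and> m2 (m2 v) = v \<and> m2 v \<noteq> v" if "v \<in> V" for v
    using m2 that R(3) d unfolding perfect_matching_def irrefl_def by auto
  have r1: "(v, m1 v) \<in> R" if "v \<in> V" "v \<noteq> a" "v \<noteq> c" for v
    using m1 that unfolding perfect_matching_def by auto
  have r2: "(v, m2 v) \<in> R" if "v \<in> V" "v \<noteq> b" "v \<noteq> d" for v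
    using m2 that unfolding perfect_matching_def by auto
  have m1ac: "m1 a = c" "m1 c = a" using True i1 V by auto
  have m2bd: "m2 b = d" "m2 d = b" using True i2 V by auto
  \<comment> \<open>\<open>z n\<close> and \<open>q n\<close> are the even and the odd positions of the alternating walk from \<open>b\<close>.\<close>
  define z where "z n = ((m1 \<circ> m2) ^^ n) b" for n
  define q where "q n = m2 (z n)" for n
  have z0: "z 0 = b" and zS: "z (Suc n) = m1 (q n)" for n by (simp_all add: z_def q_def)
  have zV: "z n \<in> V" for n
    by (induction n) (use V i1 i2 in \<open>auto simp: z0 zS q_def\<close>)
  have qV: "q n \<in> V" for n using zV i2 by (simp add: q_def)
  have m1z: "m1 (z (Suc n)) = q n" for n using zS qV i1 by simp
  have m2q: "m2 (q n) = z n" for n using zV i2 by (simp add: q_def)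
  show ?thesis
  proof (cases "\<exists>n. q n \<in> {a, c}")
    case False
    have z_ac: "z n \<notin> {a, c}" for n
    proof (cases n)
      case 0
      then show ?thesis using z0 ba by simp
    next
      case (Suc j)
      then show ?thesis using m1z[of j] m1ac False by auto
    qed
    define Z where "Z = range z"
    define Q where "Q = m2 ` Z"
    have Q: "Q = range q" by (auto simp: Q_def Z_def q_def)
    have finZ: "finite Z" using fin zV by (auto simp: Z_def intro: finite_subset)
    have cardQ: "card Q = card Z"
      unfolding Q_def using zV i2 by (intro card_image inj_onI) (auto simp: Z_def, metis)
    have "card (m1 ` Q) = card Q"
      using qV i1 by (intro card_image inj_onI) (auto simp: Q, metis)
    moreover have "m1 ` Q \<subseteq> Z" using zS by (auto simp: Q Z_def simp flip: zS)
    \<comment> \<open>\<open>m1\<close> maps \<open>Q\<close> injectively into \<open>Z\<close>, which has the same size, so the walk closes up.\<close>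
    ultimately have m1Q: "m1 ` Q = Z" using finZ cardQ by (metis card_subset_eq)
    have m1Z: "m1 ` Z = Q"
      unfolding m1Q[symmetric] image_image using qV i1 by (force simp: Q)
    let ?O = "Z \<union> Q"
    have O1: "m1 x \<in> ?O" if "x \<in> ?O" for x using that m1Q m1Z by blast
    have O2: "m2 x \<in> ?O" if "x \<in> ?O" for x
      using that by (auto simp: Q Z_def m2q simp flip: q_def)
    have O2': "m2 x \<notin> ?O" if "x \<in> V" "x \<notin> ?O" for x using O2 i2 that by metis
    have Oac: "a \<notin> ?O" "c \<notin> ?O" using z_ac False by (auto simp: Z_def Q)
    have Obd: "b \<in> ?O" "d \<in> ?O"
      using z0 m2bd q_def[of 0] by (auto simp: Z_def Q intro: range_eqI[of _ _ 0])
    have "perfect_matching V R (\<lambda>x. if x \<in> ?O then m1 x else m2 x)"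
      unfolding perfect_matching_def
    proof
      fix v assume v: "v \<in> V"
      show "(if v \<in> ?O then m1 v else m2 v) \<in> V \<and>
        (if (if v \<in> ?O then m1 v else m2 v) \<in> ?O
         then m1 (if v \<in> ?O then m1 v else m2 v) else m2 (if v \<in> ?O then m1 v else m2 v)) = v \<and>
        (v, if v \<in> ?O then m1 v else m2 v) \<in> R"
      proof (cases "v \<in> ?O")
        case True
        then have "v \<noteq> a" "v \<noteq> c" using Oac by auto
        then show ?thesis using O1[OF True] True i1[OF v] r1[OF v] by simp
      next
        case False
        then have "v \<noteq> b" "v \<noteq> d" using Obd by auto
        then show ?thesis using O2'[OF v False] False i2[OF v] r2[OF v] by simp
      qed
    qed
    then show ?thesis by blast
  next
    case True
    \<comment> \<open>An even position \<open>z (j + 1)\<close> in \<open>{a, c}\<close> has its \<open>m1\<close>-partner \<open>q j\<close> there too, so the first visit is at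
    an odd position.\<close>
    define n where "n = (LEAST n. q n \<in> {a, c})"
    have qn: "q n \<in> {a, c}" unfolding n_def using True by (rule LeastI_ex)
    have least: "q i \<notin> {a, c}" if "i < n" for i
      using that not_less_Least unfolding n_def by blast
    have z_ac: "z i \<notin> {a, c}" if "i \<le> n" for i
    proof (cases i)
      case 0
      then show ?thesis using z0 ba by simp
    next
      case (Suc j)
      then show ?thesis using m1z[of j] m1ac least[of j] that by auto
    qed
    have qb: "q i \<noteq> b" for i
      using alternating_walk_no_odd_return[of V m1 m2 b i] i1 i2 V by (simp add: q_def z_def)
    have zb: "z i \<noteq> b" if "0 < i" "i \<le> n" for i
    proof
      assume "z i = b"
      then have "z n = z (n - i)"
        using that by (metis z_def le_add_diff_inverse2 funpow_add comp_apply)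
      then have "q (n - i) \<in> {a, c}" using qn by (simp add: q_def)
      then show False using least[of "n - i"] that by simp
    qed
    \<comment> \<open>\<open>P\<close> is the walk up to \<open>q n\<close>, which \<open>m2\<close> pairs up; \<open>I\<close> is its interior, which \<open>m1\<close> pairs up.\<close>
    define I where "I = q ` {..<n} \<union> z ` {0<..n}"
    define P where "P = z ` {..n} \<union> q ` {..n}"
    have P: "P = I \<union> {b, q n}"
    proof -
      have "{..n} = insert 0 {0<..n}" "{..n} = insert n {..<n}" by auto
      then have "z ` {..n} = insert b (z ` {0<..n})" "q ` {..n} = insert (q n) (q ` {..<n})"
        using z0 by (metis image_insert)+
      then show ?thesis unfolding P_def I_def by auto
    qed
    have Iac: "a \<notin> I" "c \<notin> I" using least z_ac by (fastforce simp: I_def)+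
    have Ib: "b \<notin> I" "q n \<notin> I" 
    proof -
      show "b \<notin> I" unfolding I_def using qb zb by (metis UnE greaterThanAtMost_iff imageE)
      show "q n \<notin> I" using Iac qn by auto
    qed
    have I1: "m1 x \<in> I" if x: "x \<in> I" for x
    proof -
      consider i where "x = q i" "i < n" | i where "x = z i" "0 < i" "i \<le> n"
        using x by (auto simp: I_def)
      then show ?thesis
      proof cases
        case 1
        then have "m1 x = z (Suc i)" "Suc i \<in> {0<..n}" by (simp_all add: zS)
        then show ?thesis unfolding I_def by blast
      next
        case 2
        then obtain j where "i = Suc j" by (cases i) auto
        then have "m1 x = q j" "j \<in> {..<n}" using 2 by (simp_all add: m1z)
        then show ?thesis unfolding I_def by blast
      qed
    qed
    have P2: "m2 x \<in> P" if "x \<in> P" for x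
      using that by (auto simp: P_def m2q simp flip: q_def)
    have P2': "m2 x \<notin> P" if "x \<in> V" "x \<notin> P" for x using P2 i2 that by metis
    have bP: "b \<in> P" "d \<in> P" "q n \<in> P" using P P2[of b] m2bd by auto
    have bqn: "(b, q n) \<in> R" "(q n, b) \<in> R" "b \<noteq> q n"
      using qn ab bc R(2) ba by (auto dest: symD)
    define m where "m x = (if x = b then q n else if x = q n then b else if x \<in> I then m1 x else m2 x)" for x
    have "perfect_matching V R m"
      unfolding perfect_matching_def
    proof
      fix v assume v: "v \<in> V"
      consider "v = b" | "v = q n" | "v \<in> I" "v \<noteq> b" "v \<noteq> q n" | "v \<notin> P"
        using P by auto
      then show "m v \<in> V \<and> m (m v) = v \<and> (v, m v) \<in> R"
      proof cases
        case 3
        then have "m1 v \<noteq> b" "m1 v \<noteq> q n" "v \<noteq> a" "v \<noteq> c" using I1[OF 3(1)] Ib Iac by auto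
        then show ?thesis using 3 I1[OF 3(1)] i1[OF v] r1[OF v] by (simp add: m_def)
      next
        case 4
        then have "v \<noteq> b" "v \<noteq> q n" "v \<notin> I" "v \<noteq> d" using bP P by auto
        moreover have "m2 v \<noteq> b" "m2 v \<noteq> q n" "m2 v \<notin> I" using P2'[OF v 4] bP P by auto
        ultimately show ?thesis using i2[OF v] r2[OF v] by (simp add: m_def)
      qed (use bqn qV V in \<open>simp_all add: m_def\<close>)
    qed
    then show ?thesis by blast
  qed
qed

section \<open>Gluing perfect matchings\<close>

lemma perfect_matching_Union:
  assumes "disjoint \<C>" and "\<And>C. C \<in> \<C> \<Longrightarrow> \<exists>m. perfect_matching C R m"
  shows "\<exists>m. perfect_matching (\<Union>\<C>) R m"
proof -
  obtain M where M: "\<And>C. C \<in> \<C> \<Longrightarrow> perfect_matching C R (M C)" using assms(2) by metis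
  define m where "m v = M (THE C. C \<in> \<C> \<and> v \<in> C) v" for v
  have m: "m v = M C v" if "C \<in> \<C>" "v \<in> C" for v C
  proof -
    have "(THE C. C \<in> \<C> \<and> v \<in> C) = C"
      using that assms(1) by (intro the_equality) (auto simp: disjoint_def)
    then show ?thesis by (simp add: m_def)
  qed
  have "perfect_matching (\<Union>\<C>) R m"
    unfolding perfect_matching_def
  proof
    fix v assume "v \<in> \<Union>\<C>"
    then obtain C where C: "C \<in> \<C>" "v \<in> C" by blast
    then show "m v \<in> \<Union>\<C> \<and> m (m v) = v \<and> (v, m v) \<in> R"
      using M[OF C(1)] m[OF C] m[OF C(1)] unfolding perfect_matching_def by auto
  qed
  then show ?thesis by blast
qed

lemma perfect_matching_Un:
  assumes "A \<inter> B = {}" "\<exists>m. perfect_matching A R m" "\<exists>m. perfect_matching B R m"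
  shows "\<exists>m. perfect_matching (A \<union> B) R m"
  using perfect_matching_Union[of "{A, B}" R] assms by (auto simp: disjoint_def Int_commute)

lemma perfect_matching_clique:
  assumes "finite A" "even (card A)" and "\<And>u v. u \<in> A \<Longrightarrow> v \<in> A \<Longrightarrow> u \<noteq> v \<Longrightarrow> (u, v) \<in> R"
  shows "\<exists>m. perfect_matching A R m"
  using assms
proof (induction "card A" arbitrary: A rule: less_induct)
  case less
  show ?case
  proof (cases "A = {}")
    case True
    then show ?thesis by (intro exI[of _ id]) (simp add: perfect_matching_def)
  next
    case False
    then obtain u where u: "u \<in> A" by blast
    have "card (A - {u}) \<noteq> 0"
      using less.prems(1,2) u False by (metis One_nat_def card_Suc_Diff1 odd_one)
    then obtain v where v: "v \<in> A" "v \<noteq> u" by (metis DiffE card_eq_0_iff ex_in_conv singletonI)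
    let ?B = "A - {u, v}"
    have card: "card A = card ?B + 2"
      using less.prems(1) u v card_mono[of A "{u, v}"] by (simp add: card_Diff_subset)
    have "\<exists>m. perfect_matching ?B R m"
      using card less.prems by (intro less.hyps) auto
    moreover have "\<exists>m. perfect_matching {u, v} R m"
      using u v less.prems(3)[of u v] less.prems(3)[of v u]
      by (intro exI[of _ "\<lambda>x. if x = u then v else u"]) (auto simp: perfect_matching_def)
    ultimately have "\<exists>m. perfect_matching (?B \<union> {u, v}) R m"
      by (intro perfect_matching_Un) auto
    moreover have "?B \<union> {u, v} = A" using u v by auto
    ultimately show ?thesis by simp
  qed
qed

lemma perfect_matching_even_card:
  assumes "finite A" "perfect_matching A R m" "irrefl R"
  shows "even (card A)"
  using assms(1,2)
proof (induction "card A" arbitrary: A rule: less_induct)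
  case less
  show ?case
  proof (cases "A = {}")
    case False
    then obtain u where u: "u \<in> A" by blast
    have mu: "m u \<in> A" "m (m u) = u" "m u \<noteq> u"
      using less.prems(2) u assms(3) by (auto simp: perfect_matching_def irrefl_def)
    have card: "card A = card (A - {u, m u}) + 2"
      using less.prems(1) u mu card_mono[of A "{u, m u}"] by (simp add: card_Diff_subset)
    have "m v \<noteq> u \<and> m v \<noteq> m u" if "v \<in> A - {u, m u}" for v
      using that less.prems(2) mu unfolding perfect_matching_def by (metis DiffE insertCI)
    then have "perfect_matching (A - {u, m u}) R m"
      using less.prems(2) unfolding perfect_matching_def by auto
    then have "even (card (A - {u, m u}))" using card less.prems(1) by (intro less.hyps) auto
    then show ?thesis using card by simp
  qed simp
qed

text \<open>The easy case of Tutte's theorem: deleting the vertices \<open>S\<close> that are adjacent to all others leaves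
  disjoint cliques. One vertex of each odd clique is matched into \<open>S\<close>, where there is room for
  all of them; what remains of every clique is even, and the unused part of \<open>S\<close> is a clique
  which is even because \<open>V\<close> is.\<close>

lemma perfect_matching_disjoint_cliques:
  assumes fin: "finite V" and ev: "even (card V)" and R: "sym R" "irrefl R"
    and S: "S \<subseteq> V" "\<And>s v. s \<in> S \<Longrightarrow> v \<in> V \<Longrightarrow> s \<noteq> v \<Longrightarrow> (s, v) \<in> R"
    and \<C>: "partition_on (V - S) \<C>"
    and clique: "\<And>C u v. C \<in> \<C> \<Longrightarrow> u \<in> C \<Longrightarrow> v \<in> C \<Longrightarrow> u \<noteq> v \<Longrightarrow> (u, v) \<in> R"
    and odd_le: "card {C \<in> \<C>. odd (card C)} \<le> card S"
  shows "\<exists>m. perfect_matching V R m"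
proof -
  let ?O = "{C \<in> \<C>. odd (card C)}"
  have U: "\<Union>\<C> = V - S" and disj: "disjoint \<C>" and ne: "{} \<notin> \<C>"
    using \<C> by (auto simp: partition_on_def)
  have fin\<C>: "finite \<C>" using fin U by (metis finite_Diff finite_UnionD)
  have finC: "finite C" "C \<subseteq> V - S" if "C \<in> \<C>" for C
    using that U fin by (auto intro: finite_subset)
  have finS: "finite S" using S fin finite_subset by blast
  obtain \<phi> where \<phi>: "\<phi> ` ?O \<subseteq> S" "inj_on \<phi> ?O"
    using odd_le fin\<C> finS card_le_inj[of ?O S] by auto
  define rep where "rep C = (SOME x. x \<in> C)" for C :: "'a set"
  have rep: "rep C \<in> C" if "C \<in> \<C>" for C
    unfolding rep_def using that ne by (metis ex_in_conv someI_ex)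
  define pairs where "pairs = (\<lambda>C. {rep C, \<phi> C}) ` ?O"
  define rests where "rests = (\<lambda>C. if odd (card C) then C - {rep C} else C) ` \<C>"
  define T where "T = S - \<phi> ` ?O"
  have pairs_pm: "\<exists>m. perfect_matching (\<Union>pairs) R m"
  proof (rule perfect_matching_Union)
    show "disjoint pairs"
      unfolding pairs_def
    proof (rule pairwise_imageI)
      fix C D assume CD: "C \<in> ?O" "D \<in> ?O" "C \<noteq> D"
      have "C \<inter> D = {}" using disjointD[OF disj] CD by simp
      then have "rep C \<noteq> rep D" using CD rep[of C] rep[of D] by (metis (lifting) IntI emptyE mem_Collect_eq)
      moreover have "\<phi> C \<noteq> \<phi> D" using CD \<phi>(2) by (metis (lifting) inj_onD)
      moreover have "rep C \<notin> S" "rep D \<notin> S" using CD rep finC by blast+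
      moreover have "\<phi> C \<in> S" "\<phi> D \<in> S" using CD \<phi>(1) by blast+
      ultimately show "disjnt {rep C, \<phi> C} {rep D, \<phi> D}" by (auto simp: disjnt_def)
    qed
    fix P assume "P \<in> pairs"
    then obtain C where C: "C \<in> ?O" "P = {rep C, \<phi> C}" by (auto simp: pairs_def)
    have "\<phi> C \<in> S" "rep C \<in> V - S" using C \<phi>(1) rep finC by blast+
    then have "rep C \<noteq> \<phi> C" by (metis DiffD2)
    moreover from this have "(\<phi> C, rep C) \<in> R"
      using S(2) \<open>\<phi> C \<in> S\<close> \<open>rep C \<in> V - S\<close> by (metis DiffD1)
    ultimately have "(\<phi> C, rep C) \<in> R" "(rep C, \<phi> C) \<in> R" "rep C \<noteq> \<phi> C"
      using symD[OF R(1)] by auto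
    then show "\<exists>m. perfect_matching P R m"
      unfolding C by (intro exI[of _ "\<lambda>x. if x = rep C then \<phi> C else rep C"])
        (auto simp: perfect_matching_def)
  qed
  have rests_pm: "\<exists>m. perfect_matching (\<Union>rests) R m"
  proof (rule perfect_matching_Union)
    show "disjoint rests"
      unfolding rests_def using disj
      by (intro pairwise_imageI) (auto simp: disjoint_def disjnt_def)
    fix P assume "P \<in> rests"
    then obtain C where C: "C \<in> \<C>" "P = (if odd (card C) then C - {rep C} else C)"
      by (auto simp: rests_def)
    show "\<exists>m. perfect_matching P R m"
      using C rep[OF C(1)] finC[OF C(1)] clique[OF C(1)]
      by (intro perfect_matching_clique) (auto split: if_splits)
  qed
  have pairsE: "\<exists>C\<in>?O. x = rep C \<or> x = \<phi> C" if "x \<in> \<Union>pairs" for x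
    using that by (auto simp: pairs_def)
  have restsE: "\<exists>D\<in>\<C>. x \<in> D \<and> (odd (card D) \<longrightarrow> x \<noteq> rep D)" if "x \<in> \<Union>rests" for x
    using that by (auto simp: rests_def split: if_splits)
  have repO: "rep C \<in> V - S" if "C \<in> ?O" for C using that rep finC by blast
  have \<phi>O: "\<phi> C \<in> S" if "C \<in> ?O" for C using that \<phi>(1) by blast
  have disj2: "\<Union>pairs \<inter> \<Union>rests = {}"
  proof -
    have False if x: "x \<in> \<Union>pairs" "x \<in> \<Union>rests" for x
    proof -
      obtain D where D: "D \<in> \<C>" "x \<in> D" "odd (card D) \<Longrightarrow> x \<noteq> rep D"
        using restsE[OF x(2)] by blast
      have "x \<notin> S" using D finC by blast
      then obtain C where C: "C \<in> ?O" "x = rep C" using pairsE[OF x(1)] \<phi>O by blast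
      then have "x \<in> C" using rep by blast
      then have "C = D" using disjointD[OF disj, of C D] C D by blast
      then show False using C D by simp
    qed
    then show ?thesis by blast
  qed
  have pm1: "\<exists>m. perfect_matching (\<Union>pairs \<union> \<Union>rests) R m"
    by (intro perfect_matching_Un disj2 pairs_pm rests_pm)
  have T: "(\<Union>pairs \<union> \<Union>rests) \<inter> T = {}"
  proof -
    have "x \<notin> T" if "x \<in> \<Union>pairs" for x
      using pairsE[OF that] repO unfolding T_def by blast
    moreover have "x \<notin> T" if "x \<in> \<Union>rests" for x
      using restsE[OF that] finC unfolding T_def by blast
    ultimately show ?thesis by blast
  qed
  have V: "(\<Union>pairs \<union> \<Union>rests) \<union> T = V"
  proof (intro equalityI subsetI)
    fix x assume "x \<in> (\<Union>pairs \<union> \<Union>rests) \<union> T"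
    then consider "x \<in> \<Union>pairs" | "x \<in> \<Union>rests" | "x \<in> T" by blast
    then show "x \<in> V"
    proof cases
      case 1
      then show ?thesis using pairsE[OF 1] repO \<phi>O S(1) by blast
    next
      case 2
      then show ?thesis using restsE[OF 2] finC by blast
    next
      case 3
      then show ?thesis using S(1) by (auto simp: T_def)
    qed
  next
    fix x assume x: "x \<in> V"
    show "x \<in> (\<Union>pairs \<union> \<Union>rests) \<union> T"
    proof (cases "x \<in> S")
      case True
      show ?thesis
      proof (cases "x \<in> \<phi> ` ?O")
        case True
        then have "x \<in> \<Union>pairs" unfolding pairs_def by blast
        then show ?thesis by blast
      qed (use \<open>x \<in> S\<close> in \<open>simp add: T_def\<close>)
    next
      case False
      then obtain C where C: "C \<in> \<C>" "x \<in> C" using x U by blast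
      show ?thesis
      proof (cases "odd (card C) \<and> x = rep C")
        case True
        then have "x \<in> {rep C, \<phi> C}" "{rep C, \<phi> C} \<in> pairs"
          using C unfolding pairs_def by blast+
        then show ?thesis by blast
      next
        case False
        then have "x \<in> (if odd (card C) then C - {rep C} else C)" using C by auto
        moreover have "(if odd (card C) then C - {rep C} else C) \<in> rests"
          using C(1) unfolding rests_def by (rule imageI)
        ultimately show ?thesis by blast
      qed
    qed
  qed
  have "even (card (\<Union>pairs \<union> \<Union>rests))"
    using pm1 perfect_matching_even_card R(2) V fin by (metis finite_Un)
  moreover have "card V = card (\<Union>pairs \<union> \<Union>rests) + card T"
    using T V fin by (metis card_Un_disjoint finite_Un)
  ultimately have "even (card T)" using ev by simp
  then have "\<exists>m. perfect_matching T R m"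
    using finS S unfolding T_def by (intro perfect_matching_clique) auto
  then show ?thesis using perfect_matching_Un[OF T pm1] V by simp
qed

section \<open>Fractional perfect matchings\<close>

text \<open>Edges of weight 0 may be added to the support without affecting the hypotheses. So one can induct
  on the number of missing pairs and assume that every added edge would create a perfect matching.
  With \<open>S\<close> the set of vertices adjacent to all others, either adjacency is transitive
  off \<open>S\<close>, or the exchange lemma applies. In the transitive case the components of \<open>V - S\<close> are
  cliques; each odd one sends weight at least 1 into \<open>S\<close>, and \<open>S\<close> can receive only \<open>card S\<close> in total,
  so there are at most \<open>card S\<close> odd cliques.\<close>

lemma perfect_matching_in_supergraph_of_support:
  fixes w :: "'a \<Rightarrow> 'a \<Rightarrow> real"
  assumes fin: "finite V"
    and nonneg: "\<And>u v. 0 \<le> w u v" and sym: "\<And>u v. w u v = w v u"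
    and one: "\<And>v. v \<in> V \<Longrightarrow> (\<Sum>u\<in>V. w v u) = 1"
    and cut: "\<And>U. U \<subseteq> V \<Longrightarrow> odd (card U) \<Longrightarrow> 1 \<le> (\<Sum>u\<in>U. \<Sum>v\<in>V - U. w u v)"
    and R: "R \<subseteq> V \<times> V" "sym R" "irrefl R"
    and supp: "\<And>u v. u \<in> V \<Longrightarrow> v \<in> V \<Longrightarrow> 0 < w u v \<Longrightarrow> (u, v) \<in> R"
  shows "\<exists>m. perfect_matching V R m"
  using R supp
proof (induction "card (V \<times> V - R)" arbitrary: R rule: less_induct)
  case less
  note R = less.prems(1-3) and supp = less.prems(4)
  define S where "S = {s \<in> V. \<forall>v\<in>V. s \<noteq> v \<longrightarrow> (s, v) \<in> R}"
  \<comment> \<open>If \<open>card V\<close> were odd, the cut of \<open>V\<close> itself, which is empty, would have weight at least 1.\<close>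
  have ev: "even (card V)"
    using cut[of V] by auto
  have grow: "\<exists>m. perfect_matching V (R \<union> {(x, y), (y, x)}) m"
    if xy: "x \<in> V" "y \<in> V" "x \<noteq> y" "(x, y) \<notin> R" for x y
  proof (rule less.hyps)
    show "card (V \<times> V - (R \<union> {(x, y), (y, x)})) < card (V \<times> V - R)"
      using xy fin by (intro psubset_card_mono) auto
    show "R \<union> {(x, y), (y, x)} \<subseteq> V \<times> V" using R xy by auto
    show "sym (R \<union> {(x, y), (y, x)})" using R by (auto simp: sym_def)
    show "irrefl (R \<union> {(x, y), (y, x)})" using R xy by (auto simp: irrefl_def)
  qed (use supp in auto)
  show ?case
  proof (cases "\<forall>a\<in>V - S. \<forall>b\<in>V - S. \<forall>c\<in>V - S. (a, b) \<in> R \<longrightarrow> (b, c) \<in> R \<longrightarrow> a \<noteq> c \<longrightarrow> (a, c) \<in> R")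
    case False
    then obtain a b c where abc: "b \<in> V - S" "a \<in> V" "c \<in> V"
        "(a, b) \<in> R" "(b, c) \<in> R" "a \<noteq> c" "(a, c) \<notin> R"
      by auto
    then obtain d where d: "d \<in> V" "b \<noteq> d" "(b, d) \<notin> R" by (auto simp: S_def)
    obtain m1 where "perfect_matching V (R \<union> {(a, c), (c, a)}) m1"
      using grow abc by blast
    moreover obtain m2 where "perfect_matching V (R \<union> {(b, d), (d, b)}) m2"
      using grow[of b d] abc d by blast
    ultimately show ?thesis
      using exchange_perfect_matchings[OF fin R] abc d by blast
  next
    case True
    define r where "r = {(u, v) \<in> (V - S) \<times> (V - S). u = v \<or> (u, v) \<in> R}"
    have equiv: "equiv (V - S) r"
    proof (rule equivI)
      show "refl_on (V - S) r" by (auto simp: r_def refl_on_def)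
      show "sym r" using R(2) by (auto simp: r_def sym_def)
      show "trans r"
      proof (rule transI)
        fix x y z assume xy: "(x, y) \<in> r" and yz: "(y, z) \<in> r"
        then have "x \<in> V - S" "y \<in> V - S" "z \<in> V - S" "x = y \<or> (x, y) \<in> R" "y = z \<or> (y, z) \<in> R"
          by (simp_all add: r_def)
        then have "x = z \<or> (x, z) \<in> R" using True by metis
        then show "(x, z) \<in> r"
          using \<open>x \<in> V - S\<close> \<open>z \<in> V - S\<close> by (simp add: r_def)
      qed
    qed (auto simp: r_def)
    define \<C> where "\<C> = (V - S) // r"
    have \<C>: "partition_on (V - S) \<C>"
      unfolding \<C>_def using equiv by (rule partition_on_quotient)
    have clique: "(u, v) \<in> R" if "C \<in> \<C>" "u \<in> C" "v \<in> C" "u \<noteq> v" for C u v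
      using quotient_eq_iff[OF equiv, of C C u v] that by (auto simp: \<C>_def r_def)
    have sub: "C \<subseteq> V - S" if "C \<in> \<C>" for C
      using that \<C> by (auto simp: partition_on_def)
    \<comment> \<open>All positive weight that leaves a clique goes to \<open>S\<close>.\<close>
    have zero: "w u v = 0" if "C \<in> \<C>" "u \<in> C" "v \<in> V - C - S" for C u v
    proof (rule ccontr)
      assume "w u v \<noteq> 0"
      then have "(u, v) \<in> r"
        using supp[of u v] nonneg[of u v] that sub[of C] by (auto simp: r_def)
      then have "v \<in> C"
        using that quotient_eq_iff[OF equiv, of C "r `` {v}" u v] sub[of C]
        by (auto simp: \<C>_def quotient_def equiv_class_self[OF equiv]) (metis equiv equivE symE transE)
      then show False using that by blast
    qed
    let ?O = "{C \<in> \<C>. odd (card C)}"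
    have finS: "finite S" using fin by (auto simp: S_def)
    have fin\<C>: "finite \<C>" using \<C> fin by (metis finite_Diff finite_UnionD partition_on_def)
    have finC: "finite C" if "C \<in> \<C>" for C using sub[OF that] fin finite_subset by blast
    have "real (card ?O) \<le> (\<Sum>C\<in>?O. \<Sum>u\<in>C. \<Sum>s\<in>S. w u s)"
    proof -
      have "1 \<le> (\<Sum>u\<in>C. \<Sum>s\<in>S. w u s)" if C: "C \<in> ?O" for C
      proof -
        have "(\<Sum>v\<in>V - C. w u v) = (\<Sum>s\<in>S. w u s)" if "u \<in> C" for u
          using C sub[of C] zero[of C u] that fin
          by (intro sum.mono_neutral_right) (auto simp: S_def)
        then show ?thesis using cut[of C] C sub[of C] by auto
      qed
      then have "(\<Sum>C\<in>?O. 1::real) \<le> (\<Sum>C\<in>?O. \<Sum>u\<in>C. \<Sum>s\<in>S. w u s)"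
        by (intro sum_mono) auto
      then show ?thesis by simp
    qed
    also have "\<dots> \<le> (\<Sum>C\<in>\<C>. \<Sum>u\<in>C. \<Sum>s\<in>S. w u s)"
      using fin\<C> nonneg by (intro sum_mono2) (auto intro!: sum_nonneg)
    also have "\<dots> = (\<Sum>u\<in>V - S. \<Sum>s\<in>S. w u s)"
      using sum.Union_disjoint[of \<C> "\<lambda>u. \<Sum>s\<in>S. w u s"] \<C> finC
      by (auto simp: partition_on_def disjoint_def)
    also have "\<dots> \<le> (\<Sum>u\<in>V. \<Sum>s\<in>S. w u s)"
      using fin nonneg by (intro sum_mono2) (auto intro!: sum_nonneg)
    also have "\<dots> = (\<Sum>s\<in>S. \<Sum>u\<in>V. w s u)"
      by (subst sum.swap) (simp add: sym)
    also have "\<dots> = real (card S)"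
      using one by (simp add: S_def)
    finally have "card ?O \<le> card S" by simp
    then show ?thesis
      using clique by (intro perfect_matching_disjoint_cliques[OF fin ev R(2,3) _ _ \<C>])
        (auto simp: S_def)
  qed
qed

text \<open>The part of Edmonds' description of the perfect matching polytope that is needed here: a
  fractional perfect matching that gives every odd cut weight at least 1 has a perfect matching in
  its support.\<close>

theorem fractional_perfect_matching:
  fixes w :: "'a \<Rightarrow> 'a \<Rightarrow> real"
  assumes fin: "finite V"
    and nonneg: "\<And>u v. 0 \<le> w u v" and sym: "\<And>u v. w u v = w v u" and "\<And>v. w v v = 0"
    and one: "\<And>v. v \<in> V \<Longrightarrow> (\<Sum>u\<in>V. w v u) = 1"
    and cut: "\<And>U. U \<subseteq> V \<Longrightarrow> odd (card U) \<Longrightarrow> 1 \<le> (\<Sum>u\<in>U. \<Sum>v\<in>V - U. w u v)"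
  shows "\<exists>m. perfect_matching V {(u, v). 0 < w u v} m"
proof -
  have "\<exists>m. perfect_matching V {(u, v) \<in> V \<times> V. 0 < w u v} m"
    using assms by (intro perfect_matching_in_supergraph_of_support[of V w]) (auto simp: sym_def irrefl_def)
  then show ?thesis unfolding perfect_matching_def by auto
qed

section \<open>Half-edges and degrees\<close>

text \<open>A multigraph is given by a set \<open>E\<close> of edge names and a map \<open>h\<close> that sends the two half-edges
  \<open>(e, False)\<close> and \<open>(e, True)\<close> to their vertices. A loop has two half-edges at the same vertex, so
  \<open>card (half_edges h E v)\<close> is the degree in which a loop counts twice, and a vertex is split by
  changing \<open>h\<close> alone.\<close>

definition half_edges :: "('e \<times> bool \<Rightarrow> 'v) \<Rightarrow> 'e set \<Rightarrow> 'v \<Rightarrow> ('e \<times> bool) set" where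
  "half_edges h E v = {y \<in> E \<times> UNIV. h y = v}"

definition boundary :: "('e \<times> bool \<Rightarrow> 'v) \<Rightarrow> 'e set \<Rightarrow> 'v set \<Rightarrow> 'e set" where
  "boundary h E A = {e \<in> E. (h (e, False) \<in> A) \<noteq> (h (e, True) \<in> A)}"

lemma finite_half_edges: "finite E \<Longrightarrow> finite (half_edges h E v)"
  by (simp add: half_edges_def)

lemma sum_half_edges: 
  "(\<Sum>y\<in>E \<times> UNIV. g y) = (\<Sum>e\<in>E. g (e, False) + g (e, True))"
proof -
  have "(\<Sum>e\<in>E. g (e, False) + g (e, True)) = (\<Sum>e\<in>E. \<Sum>b\<in>UNIV. g (e, b))"
    by (simp add: UNIV_bool)
  also have "\<dots> = (\<Sum>y\<in>E \<times> UNIV. g y)"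
    by (simp add: sum.cartesian_product)
  finally show ?thesis by simp
qed

lemma sum_half_edges_by_vertex:
  fixes g :: "'e \<times> bool \<Rightarrow> 'b::comm_monoid_add"
  assumes "finite E" "finite A"
  shows "(\<Sum>v\<in>A. \<Sum>y\<in>half_edges h E v. g y) = (\<Sum>y\<in>{y \<in> E \<times> UNIV. h y \<in> A}. g y)"
proof -
  have "half_edges h E v = {y \<in> {y \<in> E \<times> UNIV. h y \<in> A}. h y = v}" if "v \<in> A" for v
    using that by (auto simp: half_edges_def)
  then have "(\<Sum>v\<in>A. \<Sum>y\<in>half_edges h E v. g y) =
      (\<Sum>v\<in>A. \<Sum>y\<in>{y \<in> {y \<in> E \<times> UNIV. h y \<in> A}. h y = v}. g y)"
    by (intro sum.cong) auto
  also have "\<dots> = (\<Sum>y\<in>{y \<in> E \<times> UNIV. h y \<in> A}. g y)"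
    using assms by (intro sum.group) auto
  finally show ?thesis .
qed

lemma parity_card_half_edges:
  assumes "finite E"
  shows "even (card {y \<in> E \<times> UNIV. Q y}) \<longleftrightarrow> even (card {e \<in> E. Q (e, False) \<noteq> Q (e, True)})"
proof -
  have "card {y \<in> E \<times> UNIV. Q y} = (\<Sum>y\<in>E \<times> UNIV. of_bool (Q y))"
    using assms by (simp add: Collect_conj_eq Int_commute)
  also have "\<dots> = (\<Sum>e\<in>E. of_bool (Q (e, False)) + of_bool (Q (e, True)))"
    by (rule sum_half_edges)
  finally have "even (card {y \<in> E \<times> UNIV. Q y}) \<longleftrightarrow>
      even (\<Sum>e\<in>E. of_bool (Q (e, False)) + of_bool (Q (e, True)) :: nat)"
    by (rule arg_cong)
  also have "\<dots> \<longleftrightarrow> even (card {e \<in> E. odd (of_bool (Q (e, False)) + of_bool (Q (e, True)) :: nat)})"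
    by (rule even_sum_iff[OF assms])
  also have "{e \<in> E. odd (of_bool (Q (e, False)) + of_bool (Q (e, True)) :: nat)} =
      {e \<in> E. Q (e, False) \<noteq> Q (e, True)}"
    by auto
  finally show ?thesis .
qed

lemma handshake:
  assumes "finite E" "finite A"
  shows "even (\<Sum>v\<in>A. card (half_edges h E v)) \<longleftrightarrow> even (card (boundary h E A))"
proof -
  have "(\<Sum>v\<in>A. card (half_edges h E v)) = card {y \<in> E \<times> UNIV. h y \<in> A}"
    using sum_half_edges_by_vertex[OF assms, of "\<lambda>_. 1::nat" h] by simp
  then show ?thesis
    using parity_card_half_edges[OF assms(1), of "\<lambda>y. h y \<in> A"] by (simp add: boundary_def)
qed

section \<open>Rounding fractional factors\<close>

text \<open>Tutte's gadget, with weights. Its vertices are the half-edges and \<open>f v\<close> copies of every vertex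
  \<open>v\<close>. A half-edge is adjacent to the other half of its edge, with weight \<open>1 - x e\<close>, and to all
  copies of its end, which share the weight \<open>x e\<close> equally. In a perfect matching the edges whose
  halves are matched to copies form an \<open>f\<close>-factor.\<close>

fun gadget_weight ::
  "('e \<times> bool \<Rightarrow> 'v) \<Rightarrow> ('v \<Rightarrow> nat) \<Rightarrow> ('e \<Rightarrow> real) \<Rightarrow> ('e \<times> bool) + ('v \<times> nat) \<Rightarrow> ('e \<times> bool) + ('v \<times> nat) \<Rightarrow> real"
  where
  "gadget_weight h f x (Inl y) (Inl z) = (if fst y = fst z \<and> snd y \<noteq> snd z then 1 - x (fst y) else 0)"
| "gadget_weight h f x (Inl y) (Inr c) = (if h y = fst c then x (fst y) / f (fst c) else 0)"
| "gadget_weight h f x (Inr c) (Inl y) = (if h y = fst c then x (fst y) / f (fst c) else 0)"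
| "gadget_weight h f x (Inr _) (Inr _) = 0"

lemma gadget_weight_sym: "gadget_weight h f x u v = gadget_weight h f x v u"
  by (cases u; cases v) auto

text \<open>A fractional \<open>f\<close>-factor \<open>x\<close> that satisfies the blossom inequalities can be rounded to an \<open>f\<close>-factor,
  without touching the edges on which \<open>x\<close> is 0 or 1. By the theorem on perfect matchings it is
  enough to bound the odd cuts \<open>U\<close> of the gadget. If \<open>U\<close> separates two copies of the same vertex
  \<open>v\<close>, each half-edge at \<open>v\<close> already contributes at least \<open>x e / f v\<close>, in total 1. If not, let \<open>A\<close> be the set of
  vertices whose copies lie in \<open>U\<close> and \<open>F\<close> the set of edges with exactly one half in \<open>U\<close>. An
  edge of \<open>F\<close> with both or no ends in \<open>A\<close> contributes \<open>(1 - x e) + x e = 1\<close>; without such an edge, the cut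
  has at least the weight that the blossom inequality for \<open>A\<close> and \<open>F\<close> bounds from below.\<close>

theorem fractional_factor:
  fixes h :: "'e \<times> bool \<Rightarrow> 'v" and x :: "'e \<Rightarrow> real" and f :: "'v \<Rightarrow> nat"
  assumes finE: "finite E" and finV: "finite V" and hV: "\<And>y. fst y \<in> E \<Longrightarrow> h y \<in> V"
    and x01: "\<And>e. 0 \<le> x e \<and> x e \<le> 1"
    and deg: "\<And>v. v \<in> V \<Longrightarrow> (\<Sum>y\<in>half_edges h E v. x (fst y)) = f v"
    and cut: "\<And>A F. A \<subseteq> V \<Longrightarrow> F \<subseteq> boundary h E A \<Longrightarrow> odd (sum f A + card F) \<Longrightarrow>
      1 \<le> (\<Sum>e\<in>boundary h E A - F. x e) + (\<Sum>e\<in>F. 1 - x e)"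
  shows "\<exists>J\<subseteq>E. (\<forall>e\<in>J. 0 < x e) \<and> (\<forall>e\<in>E - J. x e < 1) \<and> (\<forall>v\<in>V. card (half_edges h J v) = f v)"
proof -
  let ?w = "gadget_weight h f x"
  define H where "H = E \<times> (UNIV :: bool set)"
  define K where "K = (SIGMA v:V. {..<f v})"
  define N where "N = H <+> K"
  have finH: "finite H" and finK: "finite K" and finN: "finite N"
    using finE finV by (auto simp: H_def K_def N_def)
  have hH: "h y \<in> V" if "y \<in> H" for y using that hV by (auto simp: H_def)
  \<comment> \<open>Without copies of the end of a half-edge there is no weight to pass on; this keeps the convention
    \<open>x / 0 = 0\<close> harmless.\<close>
  have no_copy: "x (fst y) = 0" if "y \<in> H" "f (h y) = 0" for y
  proof -
    have "(\<Sum>y\<in>half_edges h E (h y). x (fst y)) = 0" using deg[OF hH] that by simp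
    then have "\<forall>z\<in>half_edges h E (h y). x (fst z) = 0"
      using x01 finE by (subst (asm) sum_nonneg_eq_0_iff) (auto intro: finite_half_edges)
    then show ?thesis using that by (auto simp: half_edges_def H_def)
  qed
  have sumK: "(\<Sum>c\<in>K. g c) = (\<Sum>v\<in>V. \<Sum>i<f v. g (v, i))" for g :: "_ \<Rightarrow> real"
    unfolding K_def using finV by (subst sum.Sigma) auto
  have one: "(\<Sum>u\<in>N. ?w p u) = 1" if p: "p \<in> N" for p
  proof (cases p)
    case (Inl y)
    then have y: "y \<in> H" using p by (auto simp: N_def)
    obtain e b where eb: "y = (e, b)" by (cases y)
    have "(\<Sum>z\<in>H. ?w (Inl y) (Inl z)) = (\<Sum>z\<in>{(e, \<not> b)}. ?w (Inl y) (Inl z))"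
      using finH y eb by (intro sum.mono_neutral_right) (auto simp: H_def)
    also have "\<dots> = 1 - x e" using eb by simp
    finally have 1: "(\<Sum>z\<in>H. ?w (Inl y) (Inl z)) = 1 - x e" .
    have "(\<Sum>c\<in>K. ?w (Inl y) (Inr c)) = (\<Sum>v\<in>V. if h y = v then real (f v) * (x e / f v) else 0)"
      using eb by (auto simp: sumK intro: sum.cong)
    also have "\<dots> = real (f (h y)) * (x e / f (h y))"
      using finV hH[OF y] by (simp add: sum.delta)
    also have "\<dots> = x e" using no_copy[OF y] eb by auto
    finally show ?thesis using 1 Inl finH finK by (simp add: N_def sum.Plus)
  next
    case (Inr c)
    then obtain v i where c: "c = (v, i)" "v \<in> V" "i < f v" using p by (auto simp: N_def K_def)
    have "(\<Sum>y\<in>H. ?w (Inr c) (Inl y)) = (\<Sum>y\<in>half_edges h E v. x (fst y) / f v)"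
      unfolding half_edges_def H_def using c finE by (subst sum.inter_filter) (auto intro: sum.cong)
    also have "\<dots> = 1" using deg[OF c(2)] c by (simp flip: sum_divide_distrib)
    finally show ?thesis using Inr finH finK by (simp add: N_def sum.Plus)
  qed
  have cutN: "1 \<le> (\<Sum>u\<in>U. \<Sum>v\<in>N - U. ?w u v)" if U: "U \<subseteq> N" "odd (card U)" for U
  proof -
    \<comment> \<open>\<open>t y\<close> is the weight of the cut edges between the half-edge \<open>y\<close> and the copies of its end, and \<open>c e\<close>
      collects what the two halves of \<open>e\<close> contribute to the cut.\<close>
    define P where "P = {y \<in> H. Inl y \<in> U}"
    define a where "a v = card {i. i < f v \<and> Inr (v, i) \<in> U}" for v
    define split where "split e \<longleftrightarrow> ((e, False) \<in> P) \<noteq> ((e, True) \<in> P)" for e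
    define t where "t y = x (fst y) * (if y \<in> P then f (h y) - a (h y) else a (h y)) / f (h y)" for y
    define c where "c e = (if split e then 1 - x e else 0) + t (e, False) + t (e, True)" for e
    have a_le: "a v \<le> f v" for v
      unfolding a_def by (rule order.trans[OF card_mono[of "{..<f v}"]]) auto
    have t0: "0 \<le> t y" for y using x01 by (auto simp: t_def)
    have c0: "0 \<le> c e" for e using x01 t0 by (auto simp: c_def)
    let ?r = "\<lambda>p q. if p \<in> U \<and> q \<notin> U then ?w p q else 0"
    have "(\<Sum>u\<in>U. \<Sum>v\<in>N - U. ?w u v) = (\<Sum>p\<in>N. \<Sum>q\<in>N. ?r p q)"
    proof -
      have "(\<Sum>v\<in>N - U. ?w u v) = (\<Sum>q\<in>N. if q \<notin> U then ?w u q else 0)" for u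
        using finN by (subst sum.inter_filter[symmetric]) (auto intro: sum.cong)
      then have "(\<Sum>u\<in>U. \<Sum>v\<in>N - U. ?w u v) = (\<Sum>u\<in>U. \<Sum>q\<in>N. ?r u q)"
        by simp
      also have "\<dots> = (\<Sum>p\<in>N. \<Sum>q\<in>N. ?r p q)"
        using finN U(1) by (intro sum.mono_neutral_left) auto
      finally show ?thesis .
    qed
    also have "\<dots> = (\<Sum>y\<in>H. \<Sum>z\<in>H. ?r (Inl y) (Inl z)) + (\<Sum>y\<in>H. \<Sum>k\<in>K. ?r (Inl y) (Inr k))
        + ((\<Sum>k\<in>K. \<Sum>y\<in>H. ?r (Inr k) (Inl y)) + 0)"
      using finH finK by (simp add: N_def sum.Plus sum.distrib cong: if_cong)
    also have "(\<Sum>k\<in>K. \<Sum>y\<in>H. ?r (Inr k) (Inl y)) = (\<Sum>y\<in>H. \<Sum>k\<in>K. ?r (Inr k) (Inl y))"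
      by (rule sum.swap)
    also have "(\<Sum>y\<in>H. \<Sum>z\<in>H. ?r (Inl y) (Inl z)) + (\<Sum>y\<in>H. \<Sum>k\<in>K. ?r (Inl y) (Inr k))
        + ((\<Sum>y\<in>H. \<Sum>k\<in>K. ?r (Inr k) (Inl y)) + 0) =
      (\<Sum>y\<in>H. \<Sum>z\<in>H. ?r (Inl y) (Inl z)) +
      (\<Sum>y\<in>H. \<Sum>k\<in>K. ?r (Inl y) (Inr k) + ?r (Inr k) (Inl y))"
      by (simp add: sum.distrib)
    also have "(\<Sum>y\<in>H. \<Sum>z\<in>H. ?r (Inl y) (Inl z)) = (\<Sum>e\<in>E. if split e then 1 - x e else 0)"
    proof -
      have "(\<Sum>z\<in>H. ?r (Inl (e, b)) (Inl z)) =
          (if (e, b) \<in> P \<and> (e, \<not> b) \<notin> P then 1 - x e else 0)" if "e \<in> E" for e b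
      proof -
        have "(\<Sum>z\<in>H. ?r (Inl (e, b)) (Inl z)) = (\<Sum>z\<in>{(e, \<not> b)}. ?r (Inl (e, b)) (Inl z))"
          using finH that by (intro sum.mono_neutral_right) (auto simp: H_def)
        then show ?thesis using that by (simp add: P_def H_def)
      qed
      then show ?thesis
        unfolding H_def sum_half_edges by (intro sum.cong) (auto simp: split_def)
    qed
    also have "(\<Sum>y\<in>H. \<Sum>k\<in>K. ?r (Inl y) (Inr k) + ?r (Inr k) (Inl y)) = (\<Sum>y\<in>H. t y)"
    proof (rule sum.cong)
      fix y assume y: "y \<in> H"
      let ?v = "h y"
      have "(\<Sum>k\<in>K. ?r (Inl y) (Inr k) + ?r (Inr k) (Inl y)) =
          (\<Sum>v\<in>V. if ?v = v then \<Sum>i<f v. (if (y \<in> P) \<noteq> (Inr (v, i) \<in> U) then x (fst y) / f v else 0) else 0)"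
        unfolding sumK using y by (intro sum.cong) (auto simp: P_def intro!: sum.cong sum.neutral)
      also have "\<dots> = (\<Sum>i<f ?v. if (y \<in> P) \<noteq> (Inr (?v, i) \<in> U) then x (fst y) / f ?v else 0)"
        using finV hH[OF y] by (simp add: sum.delta)
      also have "\<dots> = (\<Sum>i\<in>{i\<in>{..<f ?v}. (y \<in> P) \<noteq> (Inr (?v, i) \<in> U)}. x (fst y) / f ?v)"
        by (subst sum.inter_filter) auto
      also have "\<dots> = real (card {i\<in>{..<f ?v}. (y \<in> P) \<noteq> (Inr (?v, i) \<in> U)}) * (x (fst y) / f ?v)"
        by simp
      also have "card {i\<in>{..<f ?v}. (y \<in> P) \<noteq> (Inr (?v, i) \<in> U)} = (if y \<in> P then f ?v - a ?v else a ?v)"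
      proof -
        have "card {i\<in>{..<f ?v}. Inr (?v, i) \<notin> U} = f ?v - a ?v"
        proof -
          have "{i\<in>{..<f ?v}. Inr (?v, i) \<notin> U} = {..<f ?v} - {i. i < f ?v \<and> Inr (?v, i) \<in> U}" by auto
          then show ?thesis by (simp add: a_def card_Diff_subset subset_eq)
        qed
        then show ?thesis by (simp add: a_def)
      qed
      finally show "(\<Sum>k\<in>K. ?r (Inl y) (Inr k) + ?r (Inr k) (Inl y)) = t y" by (simp add: t_def)
    qed simp
    finally have total: "(\<Sum>u\<in>U. \<Sum>v\<in>N - U. ?w u v) =
        (\<Sum>e\<in>E. if split e then 1 - x e else 0) + (\<Sum>y\<in>H. t y)" .
    then have total': "(\<Sum>u\<in>U. \<Sum>v\<in>N - U. ?w u v) = (\<Sum>e\<in>E. c e)"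
      unfolding H_def sum_half_edges c_def by (simp add: sum.distrib)
    show ?thesis
    proof (cases "\<exists>v\<in>V. 0 < a v \<and> a v < f v")
      case True
      then obtain v where v: "v \<in> V" "0 < a v" "a v < f v" by blast
      have "1 = (\<Sum>y\<in>half_edges h E v. x (fst y) / f v)"
        using deg[OF v(1)] v by (simp flip: sum_divide_distrib)
      also have "\<dots> \<le> (\<Sum>y\<in>half_edges h E v. t y)"
      proof (rule sum_mono)
        fix y assume "y \<in> half_edges h E v"
        then have "h y = v" by (simp add: half_edges_def)
        then have "x (fst y) * 1 \<le> x (fst y) * (if y \<in> P then f (h y) - a (h y) else a (h y))"
          using v x01 by (intro mult_left_mono) auto
        then show "x (fst y) / f v \<le> t y"
          unfolding t_def \<open>h y = v\<close> by (intro divide_right_mono) auto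
      qed
      also have "\<dots> \<le> (\<Sum>y\<in>H. t y)"
        using finH t0 by (intro sum_mono2) (auto simp: half_edges_def H_def)
      also have "\<dots> \<le> (\<Sum>e\<in>E. if split e then 1 - x e else 0) + (\<Sum>y\<in>H. t y)"
        using x01 by (auto intro!: sum_nonneg)
      finally show ?thesis using total by simp
    next
      case False
      define A where "A = {v \<in> V. 0 < a v}"
      define F where "F = {e \<in> E. split e}"
      have a_full: "a v = f v" if "v \<in> A" for v
        using that False a_le[of v] by (force simp: A_def)
      have t_eq: "t y = (if (y \<in> P) \<noteq> (h y \<in> A) then x (fst y) else 0)" if y: "y \<in> H" for y
      proof (cases "f (h y) = 0")
        case True
        then show ?thesis using no_copy[OF y] by (simp add: t_def)
      next
        case False
        have "a (h y) = (if h y \<in> A then f (h y) else 0)"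
          using a_full hH[OF y] by (auto simp: A_def)
        then show ?thesis using False by (simp add: t_def)
      qed
      have mem: "(e, b) \<in> H" if "e \<in> E" for e b using that by (simp add: H_def)
      have c_eq: "c e = (if split e then 1 - x e else 0)
          + (if ((e, False) \<in> P) \<noteq> (h (e, False) \<in> A) then x e else 0)
          + (if ((e, True) \<in> P) \<noteq> (h (e, True) \<in> A) then x e else 0)" if "e \<in> E" for e
        using mem[OF that] by (simp add: c_def t_eq)
      show ?thesis
      proof (cases "F \<subseteq> boundary h E A")
        case False
        then obtain e where e: "e \<in> E" "split e" "e \<notin> boundary h E A" by (auto simp: F_def)
        then have "1 \<le> c e" using x01[of e] by (auto simp: c_eq boundary_def split_def)
        also have "\<dots> \<le> (\<Sum>e\<in>E. c e)" using e finE c0 by (intro member_le_sum) auto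
        finally show ?thesis using total' by simp
      next
        case True
        have "card U = card P + (\<Sum>v\<in>A. f v)"
        proof -
          have "U = Inl ` P \<union> Inr ` (SIGMA v:A. {..<f v})"
          proof (intro equalityI subsetI)
            fix u assume u: "u \<in> U"
            show "u \<in> Inl ` P \<union> Inr ` (SIGMA v:A. {..<f v})"
            proof (cases u)
              case (Inl y)
              then show ?thesis using u U by (auto simp: P_def N_def)
            next
              case (Inr k)
              then obtain v i where k: "k = (v, i)" "v \<in> V" "i < f v"
                using u U by (cases k) (auto simp: N_def K_def)
              then have "0 < a v" unfolding a_def using u Inr by (subst card_gt_0_iff) auto
              then show ?thesis using k Inr by (auto simp: A_def)
            qed
          next
            fix u assume u: "u \<in> Inl ` P \<union> Inr ` (SIGMA v:A. {..<f v})"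
            have "Inr (v, i) \<in> U" if vi: "v \<in> A" "i < f v" for v i
            proof -
              have "{i. i < f v \<and> Inr (v, i) \<in> U} = {..<f v}"
                using a_full[OF vi(1)] by (intro card_subset_eq) (auto simp: a_def)
              then show ?thesis using vi by auto
            qed
            then show "u \<in> U" using u by (auto simp: P_def)
          qed
          moreover have "finite P" "finite A" using finH finV by (auto simp: P_def A_def)
          moreover have "Inl ` P \<inter> Inr ` (SIGMA v:A. {..<f v}) = {}" by auto
          ultimately show ?thesis
            by (simp add: card_Un_disjoint card_image)
        qed
        moreover have "even (card P) \<longleftrightarrow> even (card F)"
          using parity_card_half_edges[OF finE, of "\<lambda>y. y \<in> P"]
          by (simp add: F_def split_def P_def H_def)
        ultimately have "odd (sum f A + card F)" using U(2) by simp
        then have "1 \<le> (\<Sum>e\<in>boundary h E A - F. x e) + (\<Sum>e\<in>F. 1 - x e)"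
          using True by (intro cut) (auto simp: A_def)
        also have "\<dots> \<le> (\<Sum>e\<in>boundary h E A - F. c e) + (\<Sum>e\<in>F. c e)"
        proof (intro add_mono sum_mono)
          fix e assume "e \<in> boundary h E A - F"
          then show "x e \<le> c e" using x01[of e] by (auto simp: c_eq boundary_def F_def split_def)
        next
          fix e assume "e \<in> F"
          then show "1 - x e \<le> c e" using x01[of e] by (auto simp: c_eq F_def)
        qed
        also have "\<dots> = (\<Sum>e\<in>boundary h E A. c e)"
          using True finE by (subst sum.subset_diff[of F]) (auto simp: boundary_def)
        also have "\<dots> \<le> (\<Sum>e\<in>E. c e)"
          using finE c0 by (intro sum_mono2) (auto simp: boundary_def)
        finally show ?thesis using total' by simp
      qed
    qed
  qed
  have "\<exists>m. perfect_matching N {(u, v). 0 < ?w u v} m"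
  proof (rule fractional_perfect_matching)
    show "0 \<le> ?w u v" for u v using x01 by (cases u; cases v) auto
    show "?w v v = 0" for v by (cases v) auto
  qed (use finN one cutN in \<open>auto intro: gadget_weight_sym\<close>)
  then obtain m where m: "\<And>p. p \<in> N \<Longrightarrow> m p \<in> N \<and> m (m p) = p \<and> 0 < ?w p (m p)"
    by (auto simp: perfect_matching_def)
  have HN: "Inl (e, b) \<in> N" if "e \<in> E" for e b
    using that by (auto simp: N_def H_def)
  \<comment> \<open>A half-edge that is not matched to a copy is matched to the other half of its edge.\<close>
  have mate: "z = (e, \<not> b)" if "e \<in> E" "m (Inl (e, b)) = Inl z" for e b z
    using m[OF HN[OF that(1), of b]] that by (cases z) (auto split: if_splits)
  define J where "J = {e \<in> E. \<exists>k. m (Inl (e, False)) = Inr k}"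
  have J_iff: "e \<in> J \<longleftrightarrow> (\<exists>k. m (Inl (e, b)) = Inr k)" if "e \<in> E" for e b
  proof -
    have "(\<exists>k. m (Inl (e, c)) = Inr k)" if "\<exists>k. m (Inl (e, \<not> c)) = Inr k" for c
    proof (cases "m (Inl (e, c))")
      case (Inl z)
      then have "m (Inl (e, \<not> c)) = Inl (e, c)" using mate[OF \<open>e \<in> E\<close> Inl] m[OF HN[OF \<open>e \<in> E\<close>, of c]] by simp
      then show ?thesis using that by auto
    qed auto
    from this[of False] this[of True] show ?thesis
      using that by (cases b) (auto simp: J_def)
  qed
  have copy: "0 < x e \<and> k \<in> K \<and> h (e, b) = fst k" if "e \<in> E" "m (Inl (e, b)) = Inr k" for e b k
    using m[OF HN[OF that(1), of b]] that x01[of e]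
    by (auto simp: N_def zero_less_divide_iff split: if_splits)
  show ?thesis
  proof (intro exI[of _ J] conjI ballI)
    show "J \<subseteq> E" by (auto simp: J_def)
  next
    fix e assume "e \<in> J"
    then show "0 < x e" using copy by (auto simp: J_def)
  next
    fix e assume e: "e \<in> E - J"
    then obtain z where z: "m (Inl (e, False)) = Inl z"
      by (cases "m (Inl (e, False))") (auto simp: J_def)
    then show "x e < 1"
      using m[OF HN[of e False]] e by (auto split: if_splits)
  next
    fix v assume v: "v \<in> V"
    have bij: "bij_betw m (Inl ` half_edges h J v) (Inr ` ({v} \<times> {..<f v}))"
    proof (rule bij_betwI[where g = m])
      show "m \<in> Inl ` half_edges h J v \<rightarrow> Inr ` ({v} \<times> {..<f v})"
      proof
        fix p :: "('e \<times> bool) + ('v \<times> nat)" assume "p \<in> Inl ` half_edges h J v"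
        then obtain e b where p: "p = Inl (e, b)" "e \<in> J" "h (e, b) = v"
          by (auto simp: half_edges_def)
        then have "e \<in> E" by (simp add: J_def)
        then obtain k where k: "m p = Inr k" using J_iff[of e b] p by auto
        then show "m p \<in> Inr ` ({v} \<times> {..<f v})"
          using copy[OF \<open>e \<in> E\<close>, of b k] p by (cases k) (auto simp: K_def)
      qed
      show "m \<in> Inr ` ({v} \<times> {..<f v}) \<rightarrow> Inl ` half_edges h J v"
      proof
        fix p :: "('e \<times> bool) + ('v \<times> nat)" assume "p \<in> Inr ` ({v} \<times> {..<f v})"
        then obtain i where p: "p = Inr (v, i)" "i < f v" by auto
        then have pN: "p \<in> N" using v by (auto simp: N_def K_def)
        then have mp: "m p \<in> N" "m (m p) = p" "0 < ?w p (m p)" using m by auto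
        then obtain e b where eb: "m p = Inl (e, b)" using p by (cases "m p") auto
        then have "e \<in> E" using mp by (auto simp: N_def H_def)
        then have "e \<in> J" "h (e, b) = v" using J_iff[of e b] eb mp p copy[of e b] by auto
        then show "m p \<in> Inl ` half_edges h J v" using eb by (auto simp: half_edges_def)
      qed
    next
      fix p :: "('e \<times> bool) + ('v \<times> nat)" assume "p \<in> Inl ` half_edges h J v"
      then have "p \<in> N" by (auto simp: half_edges_def J_def N_def H_def)
      then show "m (m p) = p" using m by blast
    next
      fix p :: "('e \<times> bool) + ('v \<times> nat)" assume "p \<in> Inr ` ({v} \<times> {..<f v})"
      then have "p \<in> N" using v by (auto simp: N_def K_def)
      then show "m (m p) = p" using m by blast
    qed
    show "card (half_edges h J v) = f v"
      using bij_betw_same_card[OF bij] by (simp add: card_image)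
  qed
qed

section \<open>Equitable factors of the right parity\<close>

lemma finite_boundary: "finite E \<Longrightarrow> finite (boundary h E A)"
  by (simp add: boundary_def)

lemma even_boundary_if_even_degrees:
  assumes "finite E" and "\<And>v. even (card (half_edges h E v))"
  shows "even (card (boundary h E A))"
proof -
  let ?A = "A \<inter> h ` (E \<times> UNIV)"
  have "boundary h E A = boundary h E ?A" by (auto simp: boundary_def)
  moreover have "even (card (boundary h E ?A))"
    using handshake[of E ?A h] assms by (auto intro: dvd_sum)
  ultimately show ?thesis by simp
qed

lemma half_edges_loops:
  "half_edges (\<lambda>(e, b). case e of Inl e' \<Rightarrow> h (e', b) | Inr v' \<Rightarrow> v') J v =
    map_prod Inl id ` half_edges h (Inl -` J) v \<union> (if Inr v \<in> J then {Inr v} \<times> UNIV else {})"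
  by (force simp: half_edges_def image_iff split: sum.splits)

text \<open>The core of the proof. Let \<open>f v\<close> be the least number of the parity of \<open>d v\<close> that is at least \<open>d v / k\<close>.
  The constant weight \<open>1 / k\<close> gives \<open>v\<close> the degree \<open>d v / k\<close>, and a loop of weight
  \<open>y v = (f v - d v / k) / 2\<close> at each vertex \<open>v\<close> fills this up to \<open>f v\<close>. Loops lie in no cut, so a
  blossom inequality only involves some number \<open>p\<close> of edges in \<open>F\<close> and the \<open>n\<close> other edges
  of a cut; it reads \<open>n + p * (k - 1) \<ge> k\<close>, where \<open>n\<close> is odd by the handshake lemma. For \<open>p = 0\<close> this
  is the hypothesis on odd cuts, and for \<open>p \<ge> 1\<close> it is trivial. In an \<open>f\<close>-factor of
  the enlarged graph, \<open>v\<close> has degree \<open>f v\<close> or \<open>f v - 2\<close> without its loop, and the latter only if \<open>y v > 0\<close>,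
  that is, if \<open>f v > d v / k\<close>.\<close>

lemma equitable_parity_factor:
  fixes h :: "'e \<times> bool \<Rightarrow> 'v"
  assumes finE: "finite E" and k: "1 \<le> k"
    and conn: "\<And>A. odd (card (boundary h E A)) \<Longrightarrow> k \<le> card (boundary h E A)"
  shows "\<exists>J\<subseteq>E. \<forall>v. (even (card (half_edges h J v)) \<longleftrightarrow> even (card (half_edges h E v))) \<and>
    \<bar>real (card (half_edges h J v)) - real (card (half_edges h E v)) / real k\<bar> < 2"
proof -
  define V where "V = h ` (E \<times> UNIV)"
  define d where "d v = card (half_edges h E v)" for v
  define f where "f v = (LEAST n. d v \<le> n * k \<and> (even n \<longleftrightarrow> even (d v)))" for v
  have finV: "finite V" using finE by (simp add: V_def)
  have f: "d v \<le> f v * k" "even (f v) \<longleftrightarrow> even (d v)" for v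
  proof -
    have "d v \<le> d v * k \<and> (even (d v) \<longleftrightarrow> even (d v))" using k by simp
    from LeastI[of "\<lambda>n. d v \<le> n * k \<and> (even n \<longleftrightarrow> even (d v))", OF this]
    show "d v \<le> f v * k" "even (f v) \<longleftrightarrow> even (d v)" unfolding f_def by simp_all
  qed
  have f_min: "real (f v) - d v / k < 2" for v
  proof (cases "f v < 2")
    case True
    then have "real (f v) < 2" by simp
    moreover have "0 \<le> real (d v) / k" by simp
    ultimately show ?thesis by linarith
  next
    case False
    then have "\<not> (d v \<le> (f v - 2) * k \<and> (even (f v - 2) \<longleftrightarrow> even (d v)))"
      unfolding f_def by (intro not_less_Least) (simp add: f_def)
    then have "(f v - 2) * k < d v" using f(2)[of v] False by auto
    then have "real (f v - 2) * k < d v" by (metis of_nat_less_iff of_nat_mult)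
    then show ?thesis using False k by (simp add: field_simps of_nat_diff)
  qed
  define y where "y v = (real (f v) - d v / k) / 2" for v
  have y: "0 \<le> y v" "y v < 1" for v
  proof -
    have "real (d v) \<le> f v * k" using f(1)[of v] by (metis of_nat_le_iff of_nat_mult)
    then show "0 \<le> y v" using k by (simp add: y_def field_simps)
    show "y v < 1" using f_min[of v] by (simp add: y_def)
  qed
  define h' where "h' = (\<lambda>(e, b). case e of Inl e' \<Rightarrow> h (e', b) | Inr v' \<Rightarrow> v')"
  define x :: "'e + 'v \<Rightarrow> real" where "x = case_sum (\<lambda>_. 1 / real k) y"
  have he: "half_edges h' J v = map_prod Inl id ` half_edges h (Inl -` J) v \<union>
      (if Inr v \<in> J then {Inr v} \<times> UNIV else {})" for J v
    unfolding h'_def by (rule half_edges_loops)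
  have Inl_vimage: "Inl -` (E <+> V) = E" by auto
  have inj: "inj_on (map_prod Inl id) A" for A :: "('e \<times> bool) set"
    by (auto simp: inj_on_def)
  have bd: "boundary h' (E <+> V) A = Inl ` boundary h E A" for A
    by (auto simp: boundary_def h'_def)
  have "\<exists>J\<subseteq>E <+> V. (\<forall>e\<in>J. 0 < x e) \<and> (\<forall>e\<in>(E <+> V) - J. x e < 1) \<and>
      (\<forall>v\<in>V. card (half_edges h' J v) = f v)"
  proof (rule fractional_factor)
    show "finite (E <+> V)" using finE finV by simp
    show "0 \<le> x e \<and> x e \<le> 1" for e
      using y k by (cases e) (auto simp: x_def less_imp_le)
    show "h' p \<in> V" if "fst p \<in> E <+> V" for p
      using that by (cases p) (auto simp: h'_def V_def)
  next
    fix v assume v: "v \<in> V"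
    have "(\<Sum>p\<in>half_edges h' (E <+> V) v. x (fst p)) =
        (\<Sum>p\<in>map_prod Inl id ` half_edges h E v. x (fst p)) + (\<Sum>p\<in>{Inr v} \<times> (UNIV :: bool set). x (fst p))"
    proof -
      have "half_edges h' (E <+> V) v = map_prod Inl id ` half_edges h E v \<union> {Inr v} \<times> UNIV"
        using v Inl_vimage by (simp add: he InrI)
      then show ?thesis using finE by (simp only:) (subst sum.union_disjoint; auto intro: finite_half_edges)
    qed
    also have "\<dots> = d v / k + 2 * y v"
      by (simp add: sum.reindex[OF inj] sum_half_edges x_def d_def)
    also have "\<dots> = f v" using k by (simp add: y_def field_simps)
    finally show "(\<Sum>p\<in>half_edges h' (E <+> V) v. x (fst p)) = f v" .
  next
    fix A F assume A: "A \<subseteq> V" and F: "F \<subseteq> boundary h' (E <+> V) A" and odd: "odd (sum f A + card F)"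
    obtain F' where F': "F = Inl ` F'" "F' \<subseteq> boundary h E A"
      using F unfolding bd by (metis subset_imageE)
    define n p where "n = card (boundary h E A - F')" and "p = card F'"
    have finA: "finite A" using A finV finite_subset by blast
    have np: "card (boundary h E A) = n + p"
      unfolding n_def p_def using F'(2) finite_boundary[OF finE]
      by (metis card_Diff_subset card_mono finite_subset le_add_diff_inverse2)
    have "even (sum f A) \<longleftrightarrow> even (\<Sum>v\<in>A. d v)"
      using finA by (simp add: even_sum_iff f(2))
    also have "\<dots> \<longleftrightarrow> even (n + p)"
      unfolding d_def np[symmetric] by (rule handshake[OF finE finA])
    finally have n: "odd n"
      using odd F' by (auto simp: p_def card_image)
    have "k \<le> n + p * (k - 1)"
    proof (cases "p = 0")
      case True
      then show ?thesis using conn[of A] np n by simp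
    next
      case False
      then have "1 * (k - 1) \<le> p * (k - 1)" by (intro mult_right_mono) auto
      moreover have "1 \<le> n" using n by (cases n) auto
      ultimately show ?thesis by linarith
    qed
    then have "real k \<le> real (n + p * (k - 1))" by (rule of_nat_mono)
    then have "1 \<le> n * (1 / k) + p * (1 - 1 / k)"
      using k by (simp add: field_simps of_nat_diff)
    moreover have "boundary h' (E <+> V) A - F = Inl ` (boundary h E A - F')"
      unfolding bd F' by (simp add: image_set_diff)
    ultimately show "1 \<le> (\<Sum>e\<in>boundary h' (E <+> V) A - F. x e) + (\<Sum>e\<in>F. 1 - x e)"
      using F' by (simp add: sum.reindex x_def n_def p_def)
  qed fact
  then obtain J where J: "J \<subseteq> E <+> V" and pos: "\<And>e. e \<in> J \<Longrightarrow> 0 < x e"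
      and degJ: "\<And>v. v \<in> V \<Longrightarrow> card (half_edges h' J v) = f v"
    by metis
  have loop_pos: "0 < y v" if "Inr v \<in> J" for v using pos[OF that] by (simp add: x_def)
  define J' where "J' = Inl -` J"
  have J': "J' \<subseteq> E" using J by (auto simp: J'_def)
  have main: "(even (card (half_edges h J' v)) \<longleftrightarrow> even (d v)) \<and>
      \<bar>real (card (half_edges h J' v)) - d v / k\<bar> < 2" for v
  proof (cases "v \<in> V")
    case False
    then have "half_edges h J' v = {}" "half_edges h E v = {}"
      using J' by (auto simp: half_edges_def V_def)
    then show ?thesis by (simp add: d_def)
  next
    case True
    have fin: "finite (half_edges h J' v)" using J' finE finite_subset finite_half_edges by metis
    have "card (map_prod Inl id ` half_edges h J' v \<union> {Inr v :: 'e + 'v} \<times> (UNIV :: bool set)) =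
        card (half_edges h J' v) + 2"
      using fin by (subst card_Un_disjoint) (auto simp: card_image[OF inj] card_cartesian_product)
    then have "f v = card (half_edges h J' v) + (if Inr v \<in> J then 2 else 0)"
      using degJ[OF True] unfolding he J'_def[symmetric]
      by (cases "Inr v \<in> J") (simp_all add: card_image[OF inj])
    then show ?thesis
      using f(2)[of v] y[of v] loop_pos[of v] by (auto simp: y_def abs_less_iff split: if_splits)
  qed
  show ?thesis
    using J' main unfolding d_def by blast
qed

text \<open>For an even number \<open>2 * q\<close>, an upper bound \<open>2 * q\<close> on the average over \<open>K\<close> factors survives the removal of
  one factor that is less than 2 away from the average: with \<open>s = 2 * q * K - d\<close>, parity
  excludes \<open>a = 2 * q - s - 1\<close>, and smaller values of \<open>a\<close> are too far from the average.\<close>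

lemma remainder_le_even_multiple:
  fixes a d q K :: int
  assumes K: "1 \<le> K" and d: "d \<le> 2 * q * K" and a: "\<bar>a * K - d\<bar> < 2 * K"
    and parity: "even a \<longleftrightarrow> even d"
  shows "d - a \<le> 2 * q * (K - 1)"
proof (rule ccontr)
  assume contra: "\<not> ?thesis"
  define s where "s = 2 * q * K - d"
  have "0 \<le> s" using d by (simp add: s_def)
  have "even a \<longleftrightarrow> even s" using parity by (simp add: s_def)
  moreover have "a < 2 * q - s" using contra by (simp add: s_def algebra_simps)
  ultimately have "a \<le> 2 * q - s - 2" by presburger
  then have "a * K \<le> (2 * q - s - 2) * K" using K by (intro mult_right_mono) auto
  moreover have "d - 2 * K < a * K" using a by linarith
  moreover have "s * 1 \<le> s * K" using \<open>0 \<le> s\<close> K by (intro mult_left_mono) auto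
  ultimately show False by (simp add: s_def algebra_simps)
qed

text \<open>An even number is less than 2 away from an average iff every even bound on the average, from above
  or from below, is also a bound on the number. So even degrees that are equitable in the
  remaining graph are equitable in the whole graph. The lower bound is the upper bound for the
  negated numbers.\<close>

lemma equitable_share_of_remainder:
  fixes a b d k :: nat
  assumes k: "1 \<le> k" and a: "\<bar>real a - real d / real (Suc k)\<bar> < 2" and "a \<le> d"
    and parity: "even a \<longleftrightarrow> even d"
    and b: "even b" "\<bar>real b - real (d - a) / real k\<bar> < 2"
  shows "\<bar>real b - real d / real (Suc k)\<bar> < 2"
proof -
  have clear: "\<bar>real m - real n / real l\<bar> < 2 \<longleftrightarrow> \<bar>int m * int l - int n\<bar> < 2 * int l" if "1 \<le> l" for m n l
  proof -
    have "\<bar>real m - real n / real l\<bar> < 2 \<longleftrightarrow> \<bar>real m * real l - real n\<bar> < 2 * real l"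
      using that by (auto simp: abs_less_iff field_simps)
    also have "\<dots> \<longleftrightarrow> real_of_int \<bar>int m * int l - int n\<bar> < real_of_int (2 * int l)"
      by simp
    finally show ?thesis by (simp only: of_int_less_iff)
  qed
  let ?K = "int (Suc k)"
  obtain \<beta> where \<beta>: "int b = 2 * \<beta>" using b(1) by (metis even_of_nat evenE)
  have a': "\<bar>int a * ?K - int d\<bar> < 2 * ?K" using a clear[of "Suc k" a d] by simp
  have a'': "\<bar>- int a * ?K - - int d\<bar> < 2 * ?K"
  proof -
    have "- int a * ?K - - int d = - (int a * ?K - int d)" by simp
    then show ?thesis using a' by (simp only: abs_minus_cancel)
  qed
  have b': "\<bar>int b * int k - (int d - int a)\<bar> < 2 * int k"
    using b(2) clear[of k b "d - a"] k \<open>a \<le> d\<close> by (simp add: of_nat_diff)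
  have p: "even (int a) \<longleftrightarrow> even (int d)" using parity by simp
  have "\<not> int d \<le> 2 * (\<beta> - 1) * ?K"
    using remainder_le_even_multiple[of ?K "int d" "\<beta> - 1" "int a"] a' b' p \<beta>
    by (auto simp: algebra_simps)
  moreover have "\<not> - int d \<le> 2 * (- (\<beta> + 1)) * ?K"
    using remainder_le_even_multiple[of ?K "- int d" "- (\<beta> + 1)" "- int a"] a'' b' p \<beta>
    by (auto simp: algebra_simps)
  ultimately have "\<bar>int b * ?K - int d\<bar> < 2 * ?K" using \<beta> by (simp add: algebra_simps)
  then show ?thesis using clear[of "Suc k" b d] by simp
qed

text \<open>Remove one factor of the right parity. The remaining graph has only even degrees, hence no odd
  cuts, and the same can be repeated in it with one factor fewer.\<close>

theorem equitable_parity_decomposition: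
  assumes "finite E" and "1 \<le> k"
    and "\<And>A. odd (card (boundary h E A)) \<Longrightarrow> k \<le> card (boundary h E A)"
  shows "\<exists>c. c ` E \<subseteq> {1..k} \<and>
    (\<forall>v. \<forall>i\<in>{1..k}. \<bar>real (card (half_edges h {e \<in> E. c e = i} v)) - real (card (half_edges h E v)) / real k\<bar> < 2) \<and>
    (\<forall>v. \<forall>i\<in>{2..k}. even (card (half_edges h {e \<in> E. c e = i} v))) \<and>
    (\<forall>v. even (card (half_edges h {e \<in> E. c e = 1} v)) \<longleftrightarrow> even (card (half_edges h E v)))"
  using assms(2,1,3)
proof (induction k arbitrary: E rule: nat_induct_at_least)
  case base
  show ?case by (rule exI[of _ "\<lambda>_. 1"]) auto
next
  case (Suc k)
  let ?deg = "\<lambda>E v. card (half_edges h E v)"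
  obtain J where J: "J \<subseteq> E" and par: "\<And>v. even (?deg J v) \<longleftrightarrow> even (?deg E v)"
    and eq: "\<And>v. \<bar>real (?deg J v) - real (?deg E v) / real (Suc k)\<bar> < 2"
    using equitable_parity_factor[of E "Suc k" h] Suc.prems by auto
  have rest: "?deg (E - J) v = ?deg E v - ?deg J v" "?deg J v \<le> ?deg E v" for v
  proof -
    have "half_edges h (E - J) v = half_edges h E v - half_edges h J v"
      "half_edges h J v \<subseteq> half_edges h E v"
      using J by (auto simp: half_edges_def)
    then show "?deg (E - J) v = ?deg E v - ?deg J v" "?deg J v \<le> ?deg E v"
      using Suc.prems(1) finite_half_edges
      by (metis card_Diff_subset finite_subset, metis card_mono)
  qed
  have rest_even: "even (?deg (E - J) v)" for v using rest par by simp
  have "even (card (boundary h (E - J) A))" for A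
    using even_boundary_if_even_degrees rest_even Suc.prems(1) by (metis finite_Diff)
  then obtain c where c: "c ` (E - J) \<subseteq> {1..k}"
    "\<And>v i. i \<in> {1..k} \<Longrightarrow> \<bar>real (?deg {e \<in> E - J. c e = i} v) - real (?deg (E - J) v) / real k\<bar> < 2"
    "\<And>v i. i \<in> {2..k} \<Longrightarrow> even (?deg {e \<in> E - J. c e = i} v)"
    "\<And>v. even (?deg {e \<in> E - J. c e = 1} v)"
    using Suc.IH[of "E - J"] Suc.prems(1) rest_even by auto
  have c_even: "even (?deg {e \<in> E - J. c e = i} v)" if "i \<in> {1..k}" for i v
    using that c(3)[of i v] c(4)[of v] by (cases "i = 1") auto
  define c' where "c' e = (if e \<in> J then 1 else Suc (c e))" for e
  have class1: "{e \<in> E. c' e = 1} = J"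
  proof -
    have "e \<in> J" if "e \<in> E" "c e = 0" for e
      using c(1) that by (metis DiffI atLeastAtMost_iff image_subset_iff not_one_le_zero)
    then show ?thesis using J by (auto simp: c'_def)
  qed
  have class2: "{e \<in> E. c' e = Suc i} = {e \<in> E - J. c e = i}" if "1 \<le> i" for i
    using that J by (auto simp: c'_def)
  have cls: "(i = 1 \<and> {e \<in> E. c' e = i} = J) \<or> (\<exists>j\<in>{1..k}. i = Suc j \<and> {e \<in> E. c' e = i} = {e \<in> E - J. c e = j})"
    if "i \<in> {1..Suc k}" for i
  proof (cases i)
    case (Suc j)
    then show ?thesis using that class1 class2[of j] by (cases "j = 0") auto
  qed (use that in simp)
  have "\<bar>real (?deg {e \<in> E. c' e = i} v) - real (?deg E v) / real (Suc k)\<bar> < 2" if "i \<in> {1..Suc k}" for i v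
    using cls[OF that]
  proof (elim disjE conjE bexE)
    fix j assume "j \<in> {1..k}" "{e \<in> E. c' e = i} = {e \<in> E - J. c e = j}"
    then show ?thesis
      using equitable_share_of_remainder[OF Suc.hyps eq rest(2) par c_even] c(2)[of j v] rest(1) by simp
  qed (use eq in simp)
  moreover have "even (?deg {e \<in> E. c' e = i} v)" if "i \<in> {2..Suc k}" for i v
    using cls[of i] that c_even by auto
  moreover have "c' ` E \<subseteq> {1..Suc k}" using c(1) by (auto simp: c'_def)
  ultimately show ?case
    using par class1 by (intro exI[of _ c']) simp
qed

section \<open>Decompositions with at most one odd factor at each vertex\<close>

text \<open>Add a vertex \<open>None\<close>, joined to all vertices of odd degree, and decompose the resulting even graph.
  Deleting the new edges makes each odd vertex odd in exactly one factor, but could move its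
  degree there too far down. This is avoided by splitting every vertex \<open>v\<close> beforehand
  into \<open>(v, False)\<close>, whose degree is a multiple of \<open>2 * k\<close>, and \<open>(v, True)\<close>, which carries the \<open>\<rho> v < 2 * k\<close>
  remaining half-edges \<open>X v\<close> and the new edge at \<open>v\<close>. All factors then have the same degree at
  \<open>(v, False)\<close>, and degree 0 or 2 at \<open>(v, True)\<close>, so that deleting the new edge turns a 2 into a 1.\<close>

theorem equitable_one_odd_factor_decomposition:
  fixes h :: "'e \<times> bool \<Rightarrow> 'v"
  assumes finE: "finite E" and k: "1 \<le> k"
  shows "\<exists>c. c ` E \<subseteq> {1..k} \<and>
    (\<forall>v. \<forall>i\<in>{1..k}. \<bar>real (card (half_edges h {e \<in> E. c e = i} v)) - real (card (half_edges h E v)) / real k\<bar> < 2) \<and>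
    (\<forall>v. card {i \<in> {1..k}. odd (card (half_edges h {e \<in> E. c e = i} v))} \<le> 1 \<and>
      (even (card (half_edges h E v)) \<longrightarrow> {i \<in> {1..k}. odd (card (half_edges h {e \<in> E. c e = i} v))} = {}))"
proof -
  define V where "V = h ` (E \<times> UNIV)"
  define d where "d v = card (half_edges h E v)" for v
  define \<rho> where "\<rho> v = d v mod (2 * k)" for v
  define W where "W = {v \<in> V. odd (d v)}"
  have finV: "finite V" using finE by (simp add: V_def)
  have W_iff: "v \<in> W \<longleftrightarrow> odd (d v)" for v
  proof -
    have "v \<in> V" if "odd (d v)"
    proof -
      have "half_edges h E v \<noteq> {}" using that by (auto simp: d_def)
      then show ?thesis by (auto simp: half_edges_def V_def)
    qed
    then show ?thesis by (auto simp: W_def)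
  qed
  have "\<exists>X. X \<subseteq> half_edges h E v \<and> card X = \<rho> v" for v
    using obtain_subset_with_card_n[of "\<rho> v" "half_edges h E v"] by (metis \<rho>_def d_def mod_less_eq_dividend)
  then obtain X where X: "\<And>v. X v \<subseteq> half_edges h E v" "\<And>v. card (X v) = \<rho> v" by metis
  define E' :: "('e + 'v) set" where "E' = E <+> W"
  define h' :: "('e + 'v) \<times> bool \<Rightarrow> ('v \<times> bool) option" where
    "h' = (\<lambda>(e, b). case e of Inl e' \<Rightarrow> Some (h (e', b), (e', b) \<in> X (h (e', b)))
       | Inr v \<Rightarrow> if b then Some (v, True) else None)"
  have finE': "finite E'" using finE finV by (simp add: E'_def W_def)
  have inj: "inj_on (map_prod Inl id) A" for A :: "('e \<times> bool) set" by (auto simp: inj_on_def)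
  let ?lift = "\<lambda>A. (map_prod Inl id :: 'e \<times> bool \<Rightarrow> ('e + 'v) \<times> bool) ` A"
  have he_T: "half_edges h' J (Some (v, True)) =
      ?lift (half_edges h (Inl -` J) v \<inter> X v) \<union> (if Inr v \<in> J then {(Inr v, True)} else {})" for J v
    by (force simp: half_edges_def h'_def image_iff split: sum.splits if_splits)
  have he_F: "half_edges h' J (Some (v, False)) = ?lift (half_edges h (Inl -` J) v - X v)" for J v
    by (force simp: half_edges_def h'_def image_iff split: sum.splits if_splits)
  have he_N: "half_edges h' J None = (\<lambda>v. (Inr v, False)) ` (Inr -` J)" for J
    by (force simp: half_edges_def h'_def image_iff split: sum.splits if_splits)
  have finX: "finite (X v)" for v using X(1) finE finite_half_edges finite_subset by metis
  have card_T: "card (half_edges h' J (Some (v, True))) =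
      card (half_edges h (Inl -` J) v \<inter> X v) + (if Inr v \<in> J then 1 else 0)" for J v
  proof -
    have "card (?lift (half_edges h (Inl -` J) v \<inter> X v) \<union> {(Inr v, True)}) =
        card (half_edges h (Inl -` J) v \<inter> X v) + 1"
      using finX by (subst card_Un_disjoint) (auto simp: card_image[OF inj])
    then show ?thesis unfolding he_T by (cases "Inr v \<in> J") (simp_all add: card_image[OF inj])
  qed
  have card_F: "card (half_edges h' J (Some (v, False))) = card (half_edges h (Inl -` J) v - X v)" for J v
    unfolding he_F by (rule card_image[OF inj])
  have Inr_E': "Inr v \<in> E' \<longleftrightarrow> odd (d v)" for v by (auto simp: E'_def W_iff)
  have vim: "Inl -` E' = E" "Inr -` E' = W" by (auto simp: E'_def)
  have deg_T: "card (half_edges h' E' (Some (v, True))) = \<rho> v + (if odd (d v) then 1 else 0)" for v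
    using X[of v] unfolding card_T vim by (simp add: Int_absorb1 Inr_E')
  have deg_F: "card (half_edges h' E' (Some (v, False))) = 2 * k * (d v div (2 * k))" for v
  proof -
    have "card (half_edges h' E' (Some (v, False))) = d v - \<rho> v"
      unfolding card_F vim using X[of v] finX by (simp add: card_Diff_subset d_def)
    then show ?thesis by (simp add: \<rho>_def minus_mod_eq_mult_div)
  qed
  have "even (card W)"
  proof -
    have "boundary h E V = {}" by (auto simp: boundary_def V_def)
    then have "even (\<Sum>v\<in>V. d v)" using handshake[OF finE finV, of h] by (simp add: d_def)
    then show ?thesis using even_sum_iff[OF finV, of d] by (simp add: W_def)
  qed
  have even_deg: "even (card (half_edges h' E' p))" for p
  proof (cases p)
    case None
    then show ?thesis using \<open>even (card W)\<close> by (simp add: he_N vim card_image inj_on_def)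
  next
    case (Some q)
    have "even (\<rho> v) \<longleftrightarrow> even (d v)" for v by (simp add: \<rho>_def dvd_mod_iff)
    then show ?thesis using Some deg_T deg_F by (cases q; cases "snd q") auto
  qed
  obtain c where c: "c ` E' \<subseteq> {1..k}"
    "\<And>p i. i \<in> {1..k} \<Longrightarrow>
      \<bar>real (card (half_edges h' {e \<in> E'. c e = i} p)) - real (card (half_edges h' E' p)) / real k\<bar> < 2"
    "\<And>p i. i \<in> {2..k} \<Longrightarrow> even (card (half_edges h' {e \<in> E'. c e = i} p))"
    "\<And>p. even (card (half_edges h' {e \<in> E'. c e = 1} p)) \<longleftrightarrow> even (card (half_edges h' E' p))"
    using equitable_parity_decomposition[of E' k h'] finE' k
      even_boundary_if_even_degrees[OF finE' even_deg] by auto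
  have c_even: "even (card (half_edges h' {e \<in> E'. c e = i} p))" if "i \<in> {1..k}" for i p
    using that c(3)[of i p] c(4)[of p] even_deg[of p] by (cases "i = 1") auto
  \<comment> \<open>The factor \<open>i\<close> has degree \<open>u\<close> at \<open>(v, False)\<close> and \<open>t\<close> at \<open>(v, True)\<close>, and \<open>\<iota>\<close> says whether it contains
    the new edge at \<open>v\<close>.\<close>
  have main: "\<bar>real (card (half_edges h {e \<in> E. c (Inl e) = i} v)) - real (d v) / real k\<bar> < 2 \<and>
      (odd (card (half_edges h {e \<in> E. c (Inl e) = i} v)) \<longleftrightarrow> odd (d v) \<and> c (Inr v) = i)"
    if i: "i \<in> {1..k}" for i v
  proof -
    let ?J = "{e \<in> E'. c e = i}"
    let ?D = "half_edges h {e \<in> E. c (Inl e) = i} v"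
    define t where "t = card (half_edges h' ?J (Some (v, True)))"
    define u where "u = card (half_edges h' ?J (Some (v, False)))"
    define q where "q = d v div (2 * k)"
    define \<iota> :: nat where "\<iota> = (if odd (d v) \<and> c (Inr v) = i then 1 else 0)"
    have J: "Inl -` ?J = {e \<in> E. c (Inl e) = i}" "Inr v \<in> ?J \<longleftrightarrow> odd (d v) \<and> c (Inr v) = i"
      by (auto simp: E'_def W_iff)
    have finD: "finite ?D" using finE by (intro finite_half_edges) simp
    have "t = card (?D \<inter> X v) + \<iota>" unfolding t_def card_T J \<iota>_def ..
    moreover have "u = card (?D - X v)" unfolding u_def card_F J ..
    moreover have "card ?D = card (?D \<inter> X v) + card (?D - X v)"
      by (rule card_Int_Diff[OF finD])
    ultimately have D: "card ?D + \<iota> = t + u" by simp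
    have dq: "d v = 2 * k * q + \<rho> v" "\<rho> v < 2 * k" using k by (auto simp: q_def \<rho>_def)
    have even_tu: "even t" "even u" unfolding t_def u_def using c_even[OF i] by auto
    have "real (2 * k * q) / real k = 2 * q" using k by simp
    then have "\<bar>real u - 2 * real q\<bar> < 2"
      using c(2)[OF i, of "Some (v, False)"] unfolding deg_F u_def[symmetric] q_def[symmetric] by simp
    then have u: "u = 2 * q" using even_tu(2) by (auto elim!: evenE)
    have t_bound: "\<bar>real t - real (\<rho> v + (if odd (d v) then 1 else 0)) / real k\<bar> < 2"
      using c(2)[OF i, of "Some (v, True)"] unfolding deg_T t_def[symmetric] .
    have "even (\<rho> v) \<longleftrightarrow> even (d v)" by (simp add: \<rho>_def dvd_mod_iff)
    then have le: "\<rho> v + (if odd (d v) then 1 else 0) \<le> 2 * k" using dq(2) by presburger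
    have "real (\<rho> v + (if odd (d v) then 1 else 0)) / real k \<le> 2"
      using le k by (simp add: divide_le_eq flip: of_nat_mult) 
    then have "t < 4" using t_bound by linarith
    then have t: "t = 0 \<or> t = 2" using even_tu(1) by (auto elim!: evenE)
    have "\<iota> \<le> t" using D \<open>t = card (?D \<inter> X v) + \<iota>\<close> by simp
    have \<rho>0: "t = 0" if "\<rho> v = 0"
      using t_bound that t \<open>even (\<rho> v) \<longleftrightarrow> even (d v)\<close> by auto
    have frac: "0 \<le> real (\<rho> v) / real k" "real (\<rho> v) / real k < 2" "\<rho> v \<noteq> 0 \<Longrightarrow> 0 < real (\<rho> v) / real k"
      using dq(2) k by (auto simp: divide_less_eq)
    have "real (d v) / real k = 2 * real q + real (\<rho> v) / real k"
      using k dq(1) by (simp add: field_simps)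
    moreover have "real (card ?D) = real t + 2 * real q - real \<iota>" using D u by simp
    ultimately have diff: "real (card ?D) - real (d v) / real k = real t - real \<iota> - real (\<rho> v) / real k"
      by simp
    have "\<bar>real t - real \<iota> - real (\<rho> v) / real k\<bar> < 2"
    proof (cases "t = 0")
      case True
      then show ?thesis using \<open>\<iota> \<le> t\<close> frac by simp
    next
      case False
      then have "t = 2" "\<rho> v \<noteq> 0" using t \<rho>0 by auto
      moreover have "\<iota> \<le> 1" by (simp add: \<iota>_def)
      ultimately show ?thesis using frac by (auto simp: abs_less_iff)
    qed
    moreover have "odd (card ?D) \<longleftrightarrow> \<iota> = 1"
    proof -
      have "even (card ?D + \<iota>)" using D even_tu by simp
      then show ?thesis by (auto simp: \<iota>_def)
    qed
    ultimately show ?thesis unfolding diff by (simp add: \<iota>_def)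
  qed
  have odd_set: "{i \<in> {1..k}. odd (card (half_edges h {e \<in> E. c (Inl e) = i} v))} \<subseteq>
      (if odd (d v) then {c (Inr v)} else {})" for v
    using main by auto
  have "card {i \<in> {1..k}. odd (card (half_edges h {e \<in> E. c (Inl e) = i} v))} \<le> 1" for v
    by (rule order.trans[OF card_mono[OF _ odd_set[of v]]]) auto
  moreover have "{i \<in> {1..k}. odd (card (half_edges h {e \<in> E. c (Inl e) = i} v))} = {}" if "even (d v)" for v
    using odd_set[of v] that by simp
  moreover have "(\<lambda>e. c (Inl e)) ` E \<subseteq> {1..k}" using c(1) by (auto simp: E'_def)
  ultimately show ?thesis
    using main unfolding d_def by (intro exI[of _ "\<lambda>e. c (Inl e)"]) blast
qed

section \<open>Multigraphs\<close>

lemma obtain_half_edge_map: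
  obtains h :: "'e \<times> bool \<Rightarrow> 'v" where "\<And>e. ends G e = Upair (h (e, False)) (h (e, True))"
proof -
  have "\<exists>a b. ends G e = Upair a b" for e by (cases "ends G e") auto
  then obtain a b where "\<And>e. ends G e = Upair (a e) (b e)" by metis
  then show thesis by (intro that[of "\<lambda>(e, s). if s then b e else a e"]) simp
qed

lemma degree_eq_card_half_edges:
  assumes "finite (edges H)" and "\<And>e. ends H e = Upair (h (e, False)) (h (e, True))"
  shows "degree H v = card (half_edges h (edges H) v)"
proof -
  let ?F = "{e \<in> edges H. h (e, False) = v}" and ?T = "{e \<in> edges H. h (e, True) = v}"
  have "y \<in> half_edges h (edges H) v \<longleftrightarrow> y \<in> (\<lambda>e. (e, False)) ` ?F \<union> (\<lambda>e. (e, True)) ` ?T" for y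
    by (cases y; cases "snd y") (auto simp: half_edges_def)
  then have "half_edges h (edges H) v = (\<lambda>e. (e, False)) ` ?F \<union> (\<lambda>e. (e, True)) ` ?T"
    by blast
  moreover have "card ((\<lambda>e. (e, False)) ` ?F \<union> (\<lambda>e. (e, True)) ` ?T) =
      card ((\<lambda>e. (e, False)) ` ?F) + card ((\<lambda>e. (e, True)) ` ?T)"
    using assms(1) by (intro card_Un_disjoint) auto
  ultimately have "card (half_edges h (edges H) v) = card ?F + card ?T"
    by (simp add: card_image inj_on_def)
  also have "\<dots> = card (?F \<union> ?T) + card (?F \<inter> ?T)"
    using assms(1) by (intro card_Un_Int) auto
  also have "?F \<union> ?T = {e \<in> edges H. v \<in> set_uprod (ends H e)}"
    using assms(2) by auto
  also have "?F \<inter> ?T = {e \<in> edges H. ends H e = Upair v v}"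
    using assms(2) by auto
  finally show ?thesis by (simp add: degree_def)
qed

lemma cut_degree_eq_card_boundary:
  assumes "\<And>e. ends G e = Upair (h (e, False)) (h (e, True))"
  shows "cut_degree G A = card (boundary h (edges G) A)"
proof -
  have "(\<exists>u v. ends G e = Upair u v \<and> u \<in> A \<and> v \<notin> A) \<longleftrightarrow>
      (h (e, False) \<in> A) \<noteq> (h (e, True) \<in> A)" for e
    using assms by auto
  then show ?thesis by (simp add: cut_degree_def boundary_def)
qed

definition color_class :: "('v, 'e) multigraph \<Rightarrow> ('e \<Rightarrow> nat) \<Rightarrow> nat \<Rightarrow> ('v, 'e) multigraph" where
  "color_class G c i = \<lparr>verts = verts G, edges = {e \<in> edges G. c e = i}, ends = ends G\<rparr>"

lemma edge_decomposition_color_class: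
  assumes "c ` edges G \<subseteq> {1..k}"
  shows "edge_decomposition G k (color_class G c)"
  using assms by (auto simp: edge_decomposition_def factor_def color_class_def disjoint_family_on_def)

theorem corollary8p10:
  fixes G :: "('v, 'e) multigraph" and k :: nat
  assumes "finite_multigraph G" and "k \<ge> 1"
  shows "(\<exists>F. edge_decomposition G k F \<and>
            (\<forall>v\<in>verts G. \<forall>i\<in>{1..k}.
               \<bar>real (degree (F i) v) - real (degree G v) / real k\<bar> < 2) \<and>
            (\<forall>v\<in>verts G. card {j\<in>{1..k}. odd (degree (F j) v)} \<le> 1 \<and>
               (even (degree G v) \<longrightarrow> {j\<in>{1..k}. odd (degree (F j) v)} = {})))
       \<and> (odd_edge_connected k G \<longrightarrow>
          (\<exists>F. edge_decomposition G k F \<and>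
            (\<forall>v\<in>verts G. \<forall>i\<in>{1..k}.
               \<bar>real (degree (F i) v) - real (degree G v) / real k\<bar> < 2) \<and>
            (\<forall>v\<in>verts G. card {j\<in>{1..k}. odd (degree (F j) v)} \<le> 1 \<and>
               (even (degree G v) \<longrightarrow> {j\<in>{1..k}. odd (degree (F j) v)} = {})) \<and>
            (\<forall>v\<in>verts G. odd (degree G v) \<longrightarrow>
               {j\<in>{1..k}. odd (degree (F j) v)} = {1})))"
proof -
  obtain h where h: "\<And>e. ends G e = Upair (h (e, False)) (h (e, True))"
    using obtain_half_edge_map by blast
  let ?E = "edges G"
  have fin: "finite ?E" and ends: "\<And>e b. e \<in> ?E \<Longrightarrow> h (e, b) \<in> verts G"
  proof -
    show "finite ?E" using assms(1) by (simp add: finite_multigraph_def)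
    fix e b assume "e \<in> ?E"
    then have "set_uprod (ends G e) \<subseteq> verts G" using assms(1) by (auto simp: finite_multigraph_def)
    then show "h (e, b) \<in> verts G" using h[of e] by (cases b) auto
  qed
  have deg: "degree G v = card (half_edges h ?E v)" for v
    using degree_eq_card_half_edges[of G h] fin h by simp
  have deg_c: "degree (color_class G c i) v = card (half_edges h {e \<in> ?E. c e = i} v)" for c i v
    using degree_eq_card_half_edges[of "color_class G c i" h] fin h by (simp add: color_class_def)
  obtain c where c: "c ` ?E \<subseteq> {1..k}"
    "\<forall>v. \<forall>i\<in>{1..k}. \<bar>real (degree (color_class G c i) v) - real (degree G v) / real k\<bar> < 2"
    "\<forall>v. card {i \<in> {1..k}. odd (degree (color_class G c i) v)} \<le> 1 \<and>
      (even (degree G v) \<longrightarrow> {i \<in> {1..k}. odd (degree (color_class G c i) v)} = {})"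
    using equitable_one_odd_factor_decomposition[OF fin assms(2), of h]
    by (elim exE conjE) (rule that; (unfold deg deg_c)?; assumption)
  have second: "\<exists>F. edge_decomposition G k F \<and>
      (\<forall>v\<in>verts G. \<forall>i\<in>{1..k}. \<bar>real (degree (F i) v) - real (degree G v) / real k\<bar> < 2) \<and>
      (\<forall>v\<in>verts G. card {j\<in>{1..k}. odd (degree (F j) v)} \<le> 1 \<and>
         (even (degree G v) \<longrightarrow> {j\<in>{1..k}. odd (degree (F j) v)} = {})) \<and>
      (\<forall>v\<in>verts G. odd (degree G v) \<longrightarrow> {j\<in>{1..k}. odd (degree (F j) v)} = {1})"
    if conn: "odd_edge_connected k G"
  proof -
    have boundary_ge: "k \<le> card (boundary h ?E A)" if "odd (card (boundary h ?E A))" for A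
    proof -
      have "boundary h ?E A = boundary h ?E (A \<inter> verts G)"
        using ends by (auto simp: boundary_def)
      then show ?thesis
        using that conn by (auto simp: odd_edge_connected_def cut_degree_eq_card_boundary[OF h])
    qed
    obtain c where c: "c ` ?E \<subseteq> {1..k}"
      "\<forall>v. \<forall>i\<in>{1..k}. \<bar>real (degree (color_class G c i) v) - real (degree G v) / real k\<bar> < 2"
      "\<forall>v. \<forall>i\<in>{2..k}. even (degree (color_class G c i) v)"
      "\<forall>v. even (degree (color_class G c 1) v) \<longleftrightarrow> even (degree G v)"
      by (rule equitable_parity_decomposition[OF fin assms(2), of h, THEN exE], erule boundary_ge,
          elim conjE, rule that; (unfold deg deg_c)?; assumption)
    have odd: "odd (degree (color_class G c i) v) \<longleftrightarrow> i = 1 \<and> odd (degree G v)" if "i \<in> {1..k}" for i v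
      using that c(3,4) by (cases "i = 1") auto
    have odd_set: "{j\<in>{1..k}. odd (degree (color_class G c j) v)} = (if odd (degree G v) then {1} else {})" for v
      using odd assms(2) by auto
    show ?thesis
      using c(1,2) edge_decomposition_color_class[of c G k]
      by (intro exI[of _ "color_class G c"]) (simp only: odd_set, simp)
  qed
  show ?thesis
  proof (intro conjI impI)
    show "\<exists>F. edge_decomposition G k F \<and>
        (\<forall>v\<in>verts G. \<forall>i\<in>{1..k}. \<bar>real (degree (F i) v) - real (degree G v) / real k\<bar> < 2) \<and>
        (\<forall>v\<in>verts G. card {j\<in>{1..k}. odd (degree (F j) v)} \<le> 1 \<and>
           (even (degree G v) \<longrightarrow> {j\<in>{1..k}. odd (degree (F j) v)} = {}))"
      using c edge_decomposition_color_class[of c G k] by (intro exI[of _ "color_class G c"]) simp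
  qed (rule second)
qed

end
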